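(* Let $H_1,H_2,K_1,K_2$ be Hilbert spaces and let $\mathcal{X}\subseteq B(H_1,H_2)$, $\mathcal{Y}\subseteq B(K_1,K_2)$ be norm-closed subspaces. If $\mathcal{X}$ and $\mathcal{Y}$ are $\sigma$-strongly TRO-equivalent and they act nondegenerately, then there exist unitary operators $U_i\in B(H_i\otimes\ell^2,K_i\otimes\ell^2)$, $i=1,2$, such that $$\mathcal{Y}\otimes\mathcal{K}=U_2(\mathcal{X}\otimes\mathcal{K})U_1^*.$$
   Context: A subspace $X\subseteq B(H,K)$ acts nondegenerately if $\overline{[XH]}=K$ and $\overline{[X^*K]}=H$ (closed linear spans). A ternary ring of operators (TRO) is a subspace $\mathcal{M}\subseteq B(H,K)$ with $\mathcal{M}\mathcal{M}^*\mathcal{M}\subseteq\mathcal{M}$. A norm-closed TRO $\mathcal{M}\subseteq B(H,K)$ is a $\sigma$-TRO if there are sequences $(m_k)_{k\in\mathbb{N}}$, $(n_k)_{k\in\mathbb{N}}$ in $\mathcal{M}$ with $\|\sum_{i=1}^k m_i^*m_i\|\le1$ and $\|\sum_{i=1}^k n_in_i^*\|\le1$ for all $k$, such that $\sum_{k=1}^\infty m\,m_k^*m_k=m$ and $\sum_{k=1}^\infty n_kn_k^*n=n$ as norm-convergent sums for all $m,n\in\mathcal{M}$. Norm-closed subspaces $\mathcal{X}\subseteq B(H_1,H_2)$, $\mathcal{Y}\subseteq B(K_1,K_2)$ are $\sigma$-strongly TRO-equivalent if there are $\sigma$-TROs $\mathcal{M}_i\subseteq B(H_i,K_i)$, $i=1,2$,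 with $\mathcal{X}=[\mathcal{M}_2^*\mathcal{Y}\mathcal{M}_1]^{-\|\cdot\|}$ and $\mathcal{Y}=[\mathcal{M}_2\mathcal{X}\mathcal{M}_1^*]^{-\|\cdot\|}$, where $[\,\cdot\,]^{-\|\cdot\|}$ denotes norm-closed linear span. $\mathcal{K}$ is the algebra of compact operators on $\ell^2=\ell^2(\mathbb{N})$, and $\otimes$ of operator spaces is the minimal tensor product: $\mathcal{X}\otimes\mathcal{K}$ is the norm-closed linear span in $B(H_1\otimes\ell^2,H_2\otimes\ell^2)$ of the operators $x\otimes k$, $x\in\mathcal{X}$, $k\in\mathcal{K}$. *)

theory Defs
  imports "HOL-Analysis.Analysis"
begin

section \<open>Complex Hilbert spaces\<close>

class complex_vector = real_vector +
  fixes scaleC :: "complex \<Rightarrow> 'a \<Rightarrow> 'a" (infixr "*\<^sub>C" 75)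
  assumes scaleC_add_right: "c *\<^sub>C (x + y) = c *\<^sub>C x + c *\<^sub>C y"
    and scaleC_add_left: "(c + d) *\<^sub>C x = c *\<^sub>C x + d *\<^sub>C x"
    and scaleC_scaleC: "c *\<^sub>C d *\<^sub>C x = (c * d) *\<^sub>C x"
    and scaleC_of_real: "complex_of_real r *\<^sub>C x = r *\<^sub>R x"

class complex_normed_vector = complex_vector + real_normed_vector +
  assumes norm_scaleC: "norm (c *\<^sub>C x) = cmod c * norm x"

text \<open>Inner products are linear in the first and conjugate-linear in the second argument.\<close>

class complex_inner = complex_normed_vector +
  fixes cinner :: "'a \<Rightarrow> 'a \<Rightarrow> complex"
  assumes cinner_commute: "cinner x y = cnj (cinner y x)"
    and cinner_add_left: "cinner (x + y) z = cinner x z + cinner y z"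
    and cinner_scaleC_left: "cinner (c *\<^sub>C x) y = c * cinner x y"
    and cinner_self: "cinner x x = complex_of_real ((norm x)\<^sup>2)"

class chilbert_space = complex_inner + complete_space

lemma scaleC_one [simp]: "1 *\<^sub>C x = (x :: 'a :: complex_vector)"
  using scaleC_of_real[of 1 x] by simp

global_interpretation complex_vector:
  vector_space "scaleC :: complex \<Rightarrow> 'a \<Rightarrow> 'a :: complex_vector"
  defines csubspace = complex_vector.subspace
    and cspan = complex_vector.span
  by unfold_locales (simp_all add: scaleC_add_right scaleC_add_left scaleC_scaleC)

lemma cinner_add_right: "cinner x (y + z) = cinner x y + cinner x (z :: 'a :: complex_inner)"
  by (metis cinner_add_left cinner_commute complex_cnj_add)

lemma cinner_scaleC_right: "cinner x (c *\<^sub>C y) = cnj c * cinner x (y :: 'a :: complex_inner)"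
  by (metis cinner_commute cinner_scaleC_left complex_cnj_mult)

lemma cinner_zero_left [simp]: "cinner 0 (y :: 'a :: complex_inner) = 0"
  using cinner_add_left[of 0 0 y] by simp

lemma cinner_zero_right [simp]: "cinner (y :: 'a :: complex_inner) 0 = 0"
  using cinner_add_right[of y 0 0] by simp

lemma cinner_minus_left: "cinner (- x) y = - cinner x (y :: 'a :: complex_inner)"
  using cinner_add_left[of x "- x" y] by (simp add: add_eq_0_iff)

lemma cinner_minus_right: "cinner x (- y) = - cinner x (y :: 'a :: complex_inner)"
  using cinner_add_right[of x y "- y"] by (simp add: add_eq_0_iff)

lemma cinner_diff_left: "cinner (x - y) z = cinner x z - cinner y (z :: 'a :: complex_inner)"
  using cinner_add_left[of x "- y" z] by (simp add: cinner_minus_left)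

lemma cinner_diff_right: "cinner z (x - y) = cinner z x - cinner z (y :: 'a :: complex_inner)"
  using cinner_add_right[of z x "- y"] by (simp add: cinner_minus_right)

lemma norm_cinner_le_half:
  fixes x y :: "'a :: complex_inner"
  shows "cmod (cinner x y) \<le> ((norm x)\<^sup>2 + (norm y)\<^sup>2) / 2"
proof -
  obtain c where c: "cmod c = 1" "c * cinner x y = complex_of_real (cmod (cinner x y))"
  proof (cases "cinner x y = 0")
    case True
    then show ?thesis using that[of 1] by simp
  next
    case False
    have "cnj (cinner x y) * cinner x y = complex_of_real (cmod (cinner x y)) ^ 2"
      using complex_norm_square[of "cinner x y"] by (simp add: mult.commute)
    then show ?thesis using False
      by (intro that[of "cnj (cinner x y) / complex_of_real (cmod (cinner x y))"])
        (simp_all add: norm_divide power2_eq_square)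
  qed
  have cc: "cinner y (c *\<^sub>C x) = complex_of_real (cmod (cinner x y))"
    by (subst cinner_commute) (simp add: cinner_scaleC_left c)
  have "complex_of_real ((norm (c *\<^sub>C x - y))\<^sup>2) = cinner (c *\<^sub>C x - y) (c *\<^sub>C x - y)"
    by (rule cinner_self[symmetric])
  also have "\<dots> = cinner (c *\<^sub>C x) (c *\<^sub>C x) - cinner (c *\<^sub>C x) y
      - (cinner y (c *\<^sub>C x) - cinner y y)"
    by (simp add: cinner_diff_left cinner_diff_right)
  also have "\<dots> = complex_of_real ((norm x)\<^sup>2 + (norm y)\<^sup>2 - 2 * cmod (cinner x y))"
    unfolding cc by (simp only: cinner_self) (simp add: cinner_scaleC_left c norm_scaleC)
  finally have "(norm (c *\<^sub>C x - y))\<^sup>2 = (norm x)\<^sup>2 + (norm y)\<^sup>2 - 2 * cmod (cinner x y)"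
    by (simp only: of_real_eq_iff)
  then show ?thesis
    using zero_le_power2[of "norm (c *\<^sub>C x - y)"] by simp
qed

instantiation complex :: chilbert_space
begin

definition scaleC_complex :: "complex \<Rightarrow> complex \<Rightarrow> complex"
  where "scaleC_complex c x = c * x"

definition cinner_complex :: "complex \<Rightarrow> complex \<Rightarrow> complex"
  where "cinner_complex x y = x * cnj y"

instance
  by standard (auto simp: scaleC_complex_def cinner_complex_def algebra_simps norm_mult
      complex_mult_cnj cmod_power2 scaleR_conv_of_real complex_eq_iff)

end

section \<open>Bounded operators\<close>

text \<open>The type \<open>'a \<Rightarrow>\<^sub>L 'b\<close> consists of the bounded real-linear maps, with the operator norm.
  The space B(H,K) is its closed complex subspace \<open>cblin\<close> of complex-linear maps.\<close>

definition cblin :: "('a :: complex_normed_vector \<Rightarrow>\<^sub>L 'b :: complex_normed_vector) set"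
  where "cblin = {T. \<forall>c x. blinfun_apply T (c *\<^sub>C x) = c *\<^sub>C blinfun_apply T x}"

lemma bounded_linear_scaleC: "bounded_linear (\<lambda>x :: 'a :: complex_normed_vector. c *\<^sub>C x)"
proof (rule bounded_linear_intro[where K = "cmod c"])
  fix r :: real and x y :: 'a
  show "c *\<^sub>C (x + y) = c *\<^sub>C x + c *\<^sub>C y"
    by (rule scaleC_add_right)
  show "c *\<^sub>C (r *\<^sub>R x) = r *\<^sub>R (c *\<^sub>C x)"
    by (simp add: scaleC_scaleC mult.commute flip: scaleC_of_real)
  show "norm (c *\<^sub>C x) \<le> norm x * cmod c"
    by (simp add: norm_scaleC)
qed

instantiation blinfun :: (real_normed_vector, complex_normed_vector) complex_normed_vector
begin

lift_definition scaleC_blinfun :: "complex \<Rightarrow> ('a \<Rightarrow>\<^sub>L 'b) \<Rightarrow> 'a \<Rightarrow>\<^sub>L 'b"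
  is "\<lambda>c T x. c *\<^sub>C T x"
  by (rule bounded_linear_compose[OF bounded_linear_scaleC])

instance
proof
  fix c d :: complex and r :: real and S T :: "'a \<Rightarrow>\<^sub>L 'b"
  show "c *\<^sub>C (S + T) = c *\<^sub>C S + c *\<^sub>C T"
    by transfer (simp add: scaleC_add_right)
  show "(c + d) *\<^sub>C T = c *\<^sub>C T + d *\<^sub>C T"
    by transfer (simp add: scaleC_add_left)
  show "c *\<^sub>C d *\<^sub>C T = (c * d) *\<^sub>C T"
    by transfer (simp add: scaleC_scaleC)
  show "complex_of_real r *\<^sub>C T = r *\<^sub>R T"
    by transfer (simp add: scaleC_of_real)
  have le: "norm (c *\<^sub>C T) \<le> cmod c * norm T" for c and T :: "'a \<Rightarrow>\<^sub>L 'b"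
  proof (rule norm_blinfun_bound)
    fix x
    have "norm (blinfun_apply (c *\<^sub>C T) x) = cmod c * norm (blinfun_apply T x)"
      by (simp add: scaleC_blinfun.rep_eq norm_scaleC)
    also have "\<dots> \<le> cmod c * (norm T * norm x)"
      by (intro mult_left_mono norm_blinfun) simp
    finally show "norm (blinfun_apply (c *\<^sub>C T) x) \<le> cmod c * norm T * norm x"
      by (simp add: mult.assoc)
  qed simp
  show "norm (c *\<^sub>C T) = cmod c * norm T"
  proof (cases "c = 0")
    case True
    then show ?thesis using le[of 0 T] by simp
  next
    case False
    have "T = inverse c *\<^sub>C (c *\<^sub>C T)"
      using False by transfer (simp add: scaleC_scaleC)
    then have "norm T \<le> inverse (cmod c) * norm (c *\<^sub>C T)"
      by (metis le norm_inverse)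
    then have "cmod c * norm T \<le> norm (c *\<^sub>C T)"
      using False by (simp add: field_simps)
    with le[of c T] show ?thesis by simp
  qed
qed

end

lemma csubspace_cblin: "csubspace cblin"
  by (auto simp: complex_vector.subspace_def cblin_def blinfun.bilinear_simps
      scaleC_blinfun.rep_eq scaleC_add_right scaleC_scaleC mult.commute)

lemma eq_0_if_cinner_eq_0:
  fixes z :: "'a :: complex_inner"
  assumes "\<And>x. cinner x z = 0"
  shows "z = 0"
  using assms[of z] by (simp add: cinner_self)

definition cadjoint :: "('a :: chilbert_space \<Rightarrow>\<^sub>L 'b :: chilbert_space) \<Rightarrow> ('b \<Rightarrow>\<^sub>L 'a)"
  where "cadjoint T = (THE S. \<forall>x y. cinner (blinfun_apply T x) y = cinner x (blinfun_apply S y))"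

lemma cadjoint_eqI:
  assumes "\<And>x y. cinner (blinfun_apply T x) y = cinner x (blinfun_apply S y)"
  shows "cadjoint T = S"
  unfolding cadjoint_def
proof (rule the_equality)
  fix R assume R: "\<forall>x y. cinner (blinfun_apply T x) y = cinner x (blinfun_apply R y)"
  show "R = S"
  proof (rule blinfun_eqI)
    fix y
    have "blinfun_apply R y - blinfun_apply S y = 0"
      by (rule eq_0_if_cinner_eq_0) (metis R assms cinner_diff_right cancel_comm_monoid_add_class.diff_cancel)
    then show "blinfun_apply R y = blinfun_apply S y" by simp
  qed
qed (use assms in blast)

definition unitary :: "('a :: chilbert_space \<Rightarrow>\<^sub>L 'b :: chilbert_space) \<Rightarrow> bool"
  where "unitary U \<longleftrightarrow> U \<in> cblin \<and>
    cadjoint U o\<^sub>L U = id_blinfun \<and> U o\<^sub>L cadjoint U = id_blinfun"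

definition compact_operators :: "('a :: chilbert_space \<Rightarrow>\<^sub>L 'b :: chilbert_space) set"
  where "compact_operators = {T \<in> cblin. compact (closure (blinfun_apply T ` cball 0 1))}"

section \<open>The Hilbert space tensor product with \<open>\<ell>\<^sup>2\<close>\<close>

text \<open>The type \<open>'a l2\<close> consists of the square-summable sequences in \<open>'a\<close>, so \<open>complex l2\<close> is
  \<open>\<ell>\<^sup>2(\<nat>)\<close>. With the bilinear map \<open>tensor_l2\<close> below, \<open>'a l2\<close> is the Hilbert space tensor product
  of \<open>'a\<close> and \<open>\<ell>\<^sup>2\<close>: inner products of elementary tensors multiply (\<open>cinner_tensor_l2\<close>), and
  elementary tensors are total (\<open>closure_cspan_tensor_l2\<close>).\<close>

typedef (overloaded) 'a l2 =
  "{f :: nat \<Rightarrow> 'a :: chilbert_space. summable (\<lambda>n. (norm (f n))\<^sup>2)}"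
  morphisms l2_nth Abs_l2
  by (rule exI[of _ "\<lambda>_. 0"]) simp

setup_lifting type_definition_l2

lemma summable_l2: "summable (\<lambda>n. (norm (l2_nth f n))\<^sup>2)"
  using l2_nth by blast

lemma norm_add_sq_le: "(norm (x + y))\<^sup>2 \<le> 2 * (norm x)\<^sup>2 + 2 * (norm (y :: 'a :: real_normed_vector))\<^sup>2"
proof -
  have "(norm (x + y))\<^sup>2 \<le> (norm x + norm y)\<^sup>2"
    by (intro power_mono norm_triangle_ineq) simp
  also have "\<dots> \<le> 2 * (norm x)\<^sup>2 + 2 * (norm y)\<^sup>2"
    using zero_le_power2[of "norm x - norm y"] by (simp add: power2_eq_square algebra_simps)
  finally show ?thesis .
qed

lemma summable_norm_sq_add:
  fixes f g :: "nat \<Rightarrow> 'a :: real_normed_vector"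
  assumes "summable (\<lambda>n. (norm (f n))\<^sup>2)" "summable (\<lambda>n. (norm (g n))\<^sup>2)"
  shows "summable (\<lambda>n. (norm (f n + g n))\<^sup>2)"
  by (rule summable_comparison_test'[where g = "\<lambda>n. 2 * (norm (f n))\<^sup>2 + 2 * (norm (g n))\<^sup>2"])
    (auto intro!: summable_add summable_mult assms simp: norm_add_sq_le)

instantiation l2 :: (chilbert_space) complex_inner
begin

lift_definition zero_l2 :: "'a l2" is "\<lambda>_. 0"
  by simp

lift_definition plus_l2 :: "'a l2 \<Rightarrow> 'a l2 \<Rightarrow> 'a l2" is "\<lambda>f g n. f n + g n"
  by (rule summable_norm_sq_add)

lift_definition uminus_l2 :: "'a l2 \<Rightarrow> 'a l2" is "\<lambda>f n. - f n"
  by simp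

lift_definition minus_l2 :: "'a l2 \<Rightarrow> 'a l2 \<Rightarrow> 'a l2" is "\<lambda>f g n. f n - g n"
  using summable_norm_sq_add[where g = "\<lambda>n. - _ n"] by fastforce

lift_definition scaleR_l2 :: "real \<Rightarrow> 'a l2 \<Rightarrow> 'a l2" is "\<lambda>r f n. r *\<^sub>R f n"
  by (simp add: power_mult_distrib summable_mult)

lift_definition scaleC_l2 :: "complex \<Rightarrow> 'a l2 \<Rightarrow> 'a l2" is "\<lambda>c f n. c *\<^sub>C f n"
  by (simp add: norm_scaleC power_mult_distrib summable_mult)

definition cinner_l2 :: "'a l2 \<Rightarrow> 'a l2 \<Rightarrow> complex"
  where "cinner_l2 f g = (\<Sum>n. cinner (l2_nth f n) (l2_nth g n))"

definition norm_l2 :: "'a l2 \<Rightarrow> real"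
  where "norm_l2 f = sqrt (\<Sum>n. (norm (l2_nth f n))\<^sup>2)"

definition sgn_l2 :: "'a l2 \<Rightarrow> 'a l2"
  where "sgn_l2 f = inverse (norm f) *\<^sub>R f"

definition dist_l2 :: "'a l2 \<Rightarrow> 'a l2 \<Rightarrow> real"
  where "dist_l2 f g = norm (f - g)"

definition uniformity_l2 :: "('a l2 \<times> 'a l2) filter"
  where "uniformity_l2 = (INF e\<in>{0<..}. principal {(f, g). dist f g < e})"

definition open_l2 :: "'a l2 set \<Rightarrow> bool"
  where "open_l2 S = (\<forall>f\<in>S. \<forall>\<^sub>F (f', g) in uniformity. f' = f \<longrightarrow> g \<in> S)"

lemma L2_set_le_norm_l2: "L2_set (\<lambda>n. norm (l2_nth f n)) {..<N} \<le> norm (f :: 'a l2)"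
  unfolding L2_set_def norm_l2_def
  by (intro real_sqrt_le_mono sum_le_suminf summable_l2) auto

lemma summable_if_L2_set_le:
  fixes f :: "nat \<Rightarrow> 'a"
  assumes "\<And>N. L2_set (\<lambda>n. norm (f n)) {..<N} \<le> C"
  shows "summable (\<lambda>n. (norm (f n))\<^sup>2)" "sqrt (\<Sum>n. (norm (f n))\<^sup>2) \<le> C"
proof -
  have C: "0 \<le> C" using assms[of 0] by simp
  have le: "(\<Sum>n<N. (norm (f n))\<^sup>2) \<le> C\<^sup>2" for N
    using assms[of N] C by (simp add: L2_set_def real_sqrt_le_iff sqrt_le_D)
  show s: "summable (\<lambda>n. (norm (f n))\<^sup>2)"
    by (rule summableI_nonneg_bounded[OF _ le]) simp
  show "sqrt (\<Sum>n. (norm (f n))\<^sup>2) \<le> C"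
    using suminf_le_const[OF s le] C by (simp add: real_le_lsqrt)
qed

lemma norm_l2_le:
  assumes "\<And>N. L2_set (\<lambda>n. norm (l2_nth f n)) {..<N} \<le> C"
  shows "norm (f :: 'a l2) \<le> C"
  using summable_if_L2_set_le(2)[OF assms] by (simp add: norm_l2_def)

lemma norm_l2_triangle: "norm (f + g) \<le> norm f + norm (g :: 'a l2)"
proof (rule norm_l2_le)
  fix N
  have "L2_set (\<lambda>n. norm (l2_nth (f + g) n)) {..<N}
      \<le> L2_set (\<lambda>n. norm (l2_nth f n) + norm (l2_nth g n)) {..<N}"
    by (rule L2_set_mono) (auto simp: plus_l2.rep_eq norm_triangle_ineq)
  also have "\<dots> \<le> L2_set (\<lambda>n. norm (l2_nth f n)) {..<N} + L2_set (\<lambda>n. norm (l2_nth g n)) {..<N}"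
    by (rule L2_set_triangle_ineq)
  also have "\<dots> \<le> norm f + norm g"
    by (intro add_mono L2_set_le_norm_l2)
  finally show "L2_set (\<lambda>n. norm (l2_nth (f + g) n)) {..<N} \<le> norm f + norm g" .
qed

lemma norm_l2_sq: "(norm (f :: 'a l2))\<^sup>2 = (\<Sum>n. (norm (l2_nth f n))\<^sup>2)"
  by (simp add: norm_l2_def suminf_nonneg summable_l2)

lemma norm_nth_le_norm_l2: "norm (l2_nth f n) \<le> norm (f :: 'a l2)"
  using member_le_L2_set[of "{..<Suc n}" n "\<lambda>n. norm (l2_nth f n)"] L2_set_le_norm_l2[of f "Suc n"]
  by simp

lemma norm_l2_scaleC: "norm (c *\<^sub>C f) = cmod c * norm (f :: 'a l2)"
  by (simp add: norm_l2_def scaleC_l2.rep_eq norm_scaleC power_mult_distrib suminf_mult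
      summable_l2 real_sqrt_mult)

lemma scaleC_of_real_l2: "complex_of_real r *\<^sub>C f = r *\<^sub>R (f :: 'a l2)"
  by transfer (simp add: scaleC_of_real)

lemma summable_cinner_l2: "summable (\<lambda>n. cinner (l2_nth f n) (l2_nth g n))"
  by (rule summable_comparison_test'[where
        g = "\<lambda>n. ((norm (l2_nth f n))\<^sup>2 + (norm (l2_nth g n))\<^sup>2) / 2"])
    (rule summable_divide summable_add summable_l2 norm_cinner_le_half)+

lemma Cauchy_l2_convergent:
  fixes X :: "nat \<Rightarrow> 'a l2"
  assumes "\<And>e. e > 0 \<Longrightarrow> \<exists>M. \<forall>m\<ge>M. \<forall>n\<ge>M. norm (X m - X n) < e"
  shows "\<exists>L. \<forall>e>0. \<exists>M. \<forall>n\<ge>M. norm (X n - L) < e"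
proof -
  have "Cauchy (\<lambda>i. l2_nth (X i) n)" for n
  proof (rule CauchyI)
    fix e :: real assume "e > 0"
    then obtain M where "\<forall>i\<ge>M. \<forall>j\<ge>M. norm (X i - X j) < e" using assms by blast
    moreover have "norm (l2_nth (X i) n - l2_nth (X j) n) \<le> norm (X i - X j)" for i j
      using norm_nth_le_norm_l2[of "X i - X j" n] by (simp add: minus_l2.rep_eq)
    ultimately show "\<exists>M. \<forall>i\<ge>M. \<forall>j\<ge>M. norm (l2_nth (X i) n - l2_nth (X j) n) < e"
      by (meson le_less_trans)
  qed
  then have "\<forall>n. \<exists>l. (\<lambda>i. l2_nth (X i) n) \<longlonglongrightarrow> l"
    by (simp add: Cauchy_convergent_iff convergent_def)
  then obtain l where l: "\<And>n. (\<lambda>i. l2_nth (X i) n) \<longlonglongrightarrow> l n"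
    by metis
  have bound: "L2_set (\<lambda>n. norm (l2_nth (X i) n - l n)) {..<N} \<le> e"
    if "\<forall>i\<ge>M. \<forall>j\<ge>M. norm (X i - X j) < e" "i \<ge> M" for M e i N
  proof (rule tendsto_upperbound)
    show "(\<lambda>j. L2_set (\<lambda>n. norm (l2_nth (X i) n - l2_nth (X j) n)) {..<N})
        \<longlonglongrightarrow> L2_set (\<lambda>n. norm (l2_nth (X i) n - l n)) {..<N}"
      unfolding L2_set_def by (intro tendsto_intros l)
    show "\<forall>\<^sub>F j in sequentially. L2_set (\<lambda>n. norm (l2_nth (X i) n - l2_nth (X j) n)) {..<N} \<le> e"
    proof (rule eventually_sequentiallyI[of M])
      fix j assume "j \<ge> M"
      then show "L2_set (\<lambda>n. norm (l2_nth (X i) n - l2_nth (X j) n)) {..<N} \<le> e"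
        using L2_set_le_norm_l2[of "X i - X j" N] that by (fastforce simp: minus_l2.rep_eq)
    qed
  qed simp
  have sm: "summable (\<lambda>n. (norm (l n))\<^sup>2)"
  proof -
    obtain M where M: "\<forall>i\<ge>M. \<forall>j\<ge>M. norm (X i - X j) < 1"
      using assms[of 1] by auto
    have "summable (\<lambda>n. (norm (l2_nth (X M) n - l n))\<^sup>2)"
      by (rule summable_if_L2_set_le(1)[OF bound[OF M order_refl]])
    then have "summable (\<lambda>n. (norm (l n - l2_nth (X M) n))\<^sup>2)"
      by (simp add: norm_minus_commute)
    from summable_norm_sq_add[OF this summable_l2[of "X M"]] show ?thesis
      by simp
  qed
  define L where "L = Abs_l2 l"
  have L: "l2_nth L = l"
    unfolding L_def using sm by (simp add: Abs_l2_inverse)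
  show ?thesis
  proof (intro exI[of _ L] allI impI)
    fix e :: real assume "e > 0"
    then obtain M where M: "\<forall>i\<ge>M. \<forall>j\<ge>M. norm (X i - X j) < e / 2"
      using assms[of "e / 2"] by auto
    have "norm (X i - L) \<le> e / 2" if "i \<ge> M" for i
      using bound[OF M that] by (intro norm_l2_le) (simp add: minus_l2.rep_eq L)
    then show "\<exists>M. \<forall>n\<ge>M. norm (X n - L) < e"
      using \<open>e > 0\<close> by (intro exI[of _ M]) fastforce
  qed
qed

instance
proof
  fix f g h :: "'a l2" and c d :: complex and r s :: real
  show "f + g + h = f + (g + h)" by transfer (simp add: add.assoc)
  show "f + g = g + f" by transfer (simp add: add.commute)
  show "0 + f = f" by transfer simp
  show "- f + f = 0" by transfer simp
  show "f - g = f + - g" by transfer simp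
  show "r *\<^sub>R (f + g) = r *\<^sub>R f + r *\<^sub>R g" by transfer (simp add: scaleR_add_right)
  show "(r + s) *\<^sub>R f = r *\<^sub>R f + s *\<^sub>R f" by transfer (simp add: scaleR_add_left)
  show "r *\<^sub>R s *\<^sub>R f = (r * s) *\<^sub>R f" by transfer simp
  show "1 *\<^sub>R f = f" by transfer simp
  show "c *\<^sub>C (f + g) = c *\<^sub>C f + c *\<^sub>C g" by transfer (simp add: scaleC_add_right)
  show "(c + d) *\<^sub>C f = c *\<^sub>C f + d *\<^sub>C f" by transfer (simp add: scaleC_add_left)
  show "c *\<^sub>C d *\<^sub>C f = (c * d) *\<^sub>C f" by transfer (simp add: scaleC_scaleC)
  show "complex_of_real r *\<^sub>C f = r *\<^sub>R f" by (rule scaleC_of_real_l2)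
  show "dist f g = norm (f - g)" by (rule dist_l2_def)
  show "sgn f = inverse (norm f) *\<^sub>R f" by (rule sgn_l2_def)
  show "(uniformity :: ('a l2 \<times> 'a l2) filter) = (INF e\<in>{0<..}. principal {(f, g). dist f g < e})"
    by (rule uniformity_l2_def)
  show "open S = (\<forall>f\<in>S. \<forall>\<^sub>F (f', g) in uniformity. f' = f \<longrightarrow> g \<in> S)" for S :: "'a l2 set"
    by (rule open_l2_def)
  show "norm f = 0 \<longleftrightarrow> f = 0"
  proof
    assume "norm f = 0"
    then have "l2_nth f n = 0" for n
      using norm_nth_le_norm_l2[of f n] by simp
    then show "f = 0" by (simp add: l2_nth_inject[symmetric] zero_l2.rep_eq fun_eq_iff)
  qed (simp add: norm_l2_def zero_l2.rep_eq)
  show "norm (f + g) \<le> norm f + norm g" by (rule norm_l2_triangle)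
  show "norm (c *\<^sub>C f) = cmod c * norm f" by (rule norm_l2_scaleC)
  show "norm (r *\<^sub>R f) = \<bar>r\<bar> * norm f"
    using norm_l2_scaleC[of "complex_of_real r" f] by (simp add: scaleC_of_real_l2)
  show "cinner f g = cnj (cinner g f)"
  proof -
    have "cinner f g = (\<Sum>n. cnj (cinner (l2_nth g n) (l2_nth f n)))"
      by (simp add: cinner_l2_def cinner_commute[symmetric])
    also have "\<dots> = cnj (cinner g f)"
      unfolding cinner_l2_def
      by (rule bounded_linear.suminf[OF bounded_linear_cnj summable_cinner_l2, symmetric])
    finally show ?thesis .
  qed
  show "cinner (f + g) h = cinner f h + cinner g h"
    by (simp add: cinner_l2_def plus_l2.rep_eq cinner_add_left suminf_add summable_cinner_l2)
  show "cinner (c *\<^sub>C f) g = c * cinner f g"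
    by (simp add: cinner_l2_def scaleC_l2.rep_eq cinner_scaleC_left suminf_mult summable_cinner_l2)
  show "cinner f f = complex_of_real ((norm f)\<^sup>2)"
    unfolding norm_l2_sq by (simp add: cinner_l2_def cinner_self suminf_of_real summable_l2)
qed

end

instance l2 :: (chilbert_space) chilbert_space
proof
  fix X :: "nat \<Rightarrow> 'a l2"
  assume "Cauchy X"
  then obtain L where "\<forall>e>0. \<exists>M. \<forall>n\<ge>M. norm (X n - L) < e"
    using Cauchy_l2_convergent[of X] by (metis CauchyD)
  then have "X \<longlonglongrightarrow> L"
    by (simp add: LIMSEQ_iff)
  then show "convergent X"
    by (rule convergentI)
qed

lift_definition tensor_l2 :: "'a :: chilbert_space \<Rightarrow> complex l2 \<Rightarrow> 'a l2" (infixr "\<otimes>\<^sub>v" 70)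
  is "\<lambda>h f n. f n *\<^sub>C h"
  by (simp add: norm_scaleC power_mult_distrib summable_mult2)

lemma tensor_l2_add_left: "(g + h) \<otimes>\<^sub>v f = g \<otimes>\<^sub>v f + h \<otimes>\<^sub>v f"
  by transfer (simp add: scaleC_add_right)

lemma tensor_l2_add_right: "h \<otimes>\<^sub>v (f + g) = h \<otimes>\<^sub>v f + h \<otimes>\<^sub>v g"
  by transfer (simp add: scaleC_add_left)

lemma tensor_l2_scaleC_left: "(c *\<^sub>C h) \<otimes>\<^sub>v f = c *\<^sub>C (h \<otimes>\<^sub>v f)"
  by transfer (simp add: scaleC_scaleC mult.commute)

lemma tensor_l2_scaleC_right: "h \<otimes>\<^sub>v (c *\<^sub>C f) = c *\<^sub>C (h \<otimes>\<^sub>v f)"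
  by transfer (simp add: scaleC_scaleC scaleC_complex_def)

lemma cinner_tensor_l2: "cinner (h \<otimes>\<^sub>v f) (h' \<otimes>\<^sub>v f') = cinner h h' * cinner f f'"
proof -
  have "cinner (h \<otimes>\<^sub>v f) (h' \<otimes>\<^sub>v f')
      = (\<Sum>n. cinner h h' * cinner (l2_nth f n) (l2_nth f' n))"
    by (simp add: cinner_l2_def tensor_l2.rep_eq cinner_scaleC_left cinner_scaleC_right
        cinner_complex_def mult_ac)
  also have "\<dots> = cinner h h' * cinner f f'"
    by (simp add: cinner_l2_def suminf_mult summable_cinner_l2)
  finally show ?thesis .
qed

lemma closure_cspan_tensor_l2:
  "closure (cspan {h \<otimes>\<^sub>v f | h f. True}) = (UNIV :: 'a :: chilbert_space l2 set)"
proof -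
  have "x \<in> closure (cspan {h \<otimes>\<^sub>v f | h f. True})" for x :: "'a l2"
    unfolding closure_sequential
  proof (intro exI conjI allI)
    define e where "e n = Abs_l2 (\<lambda>m. if m = n then 1 else 0 :: complex)" for n :: nat
    have "summable (\<lambda>m. (cmod (if m = n then 1 else 0))\<^sup>2)" for n :: nat
      by (rule summable_finite[of "{n}"]) auto
    then have e: "l2_nth (e n) m = (if m = n then 1 else 0)" for n m
      by (simp add: e_def Abs_l2_inverse)
    define T where "T N = (\<Sum>n<N. l2_nth x n \<otimes>\<^sub>v e n)" for N
    show "T N \<in> cspan {h \<otimes>\<^sub>v f | h f. True}" for N
      unfolding T_def by (intro complex_vector.span_sum complex_vector.span_base) blast
    have T: "l2_nth (T N) m = (if m < N then l2_nth x m else 0)" for N m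
      unfolding T_def
      by (induction N)
        (auto simp: zero_l2.rep_eq plus_l2.rep_eq tensor_l2.rep_eq e less_Suc_eq
          complex_vector.scale_zero_left)
    have "(norm (x - T N))\<^sup>2 = (\<Sum>n. (norm (l2_nth x (n + N)))\<^sup>2)" for N
    proof -
      have "(norm (x - T N))\<^sup>2 = (\<Sum>n. (norm (l2_nth (x - T N) n))\<^sup>2)"
        by (rule norm_l2_sq)
      also have "\<dots> = (\<Sum>n. (norm (l2_nth (x - T N) (n + N)))\<^sup>2)
          + (\<Sum>n<N. (norm (l2_nth (x - T N) n))\<^sup>2)"
        by (rule suminf_split_initial_segment[OF summable_l2])
      finally show ?thesis by (simp add: minus_l2.rep_eq T)
    qed
    moreover have "(\<lambda>N. \<Sum>n. (norm (l2_nth x (n + N)))\<^sup>2) \<longlonglongrightarrow> 0"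
      by (rule suminf_exist_split2[OF summable_l2])
    ultimately have "(\<lambda>N. (norm (x - T N))\<^sup>2) \<longlonglongrightarrow> 0"
      by simp
    from tendsto_real_sqrt[OF this] have "(\<lambda>N. norm (T N - x)) \<longlonglongrightarrow> 0"
      by (simp add: norm_minus_commute)
    then show "T \<longlonglongrightarrow> x"
      by (simp add: LIM_zero_cancel tendsto_norm_zero_iff)
  qed
  then show ?thesis by blast
qed

definition op_tensor ::
    "('a :: chilbert_space \<Rightarrow>\<^sub>L 'b :: chilbert_space) \<Rightarrow> (complex l2 \<Rightarrow>\<^sub>L complex l2) \<Rightarrow> ('a l2 \<Rightarrow>\<^sub>L 'b l2)"
  where "op_tensor x k = (THE T. T \<in> cblin \<and>
    (\<forall>h f. blinfun_apply T (h \<otimes>\<^sub>v f) = blinfun_apply x h \<otimes>\<^sub>v blinfun_apply k f))"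

lemma op_tensor_eqI:
  assumes T: "T \<in> cblin"
    "\<And>h f. blinfun_apply T (h \<otimes>\<^sub>v f) = blinfun_apply x h \<otimes>\<^sub>v blinfun_apply k f"
  shows "op_tensor x k = T"
  unfolding op_tensor_def
proof (rule the_equality)
  fix S assume S: "S \<in> cblin \<and>
    (\<forall>h f. blinfun_apply S (h \<otimes>\<^sub>v f) = blinfun_apply x h \<otimes>\<^sub>v blinfun_apply k f)"
  let ?Z = "{z. blinfun_apply S z = blinfun_apply T z}"
  have "csubspace ?Z"
    using S T(1)
    by (auto simp: complex_vector.subspace_def cblin_def blinfun.bilinear_simps)
  then have "cspan {h \<otimes>\<^sub>v f | h f. True} \<subseteq> ?Z"
    using S T(2) by (intro complex_vector.span_minimal) auto
  moreover have "closed ?Z"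
    by (intro closed_Collect_eq continuous_intros)
  ultimately have "closure (cspan {h \<otimes>\<^sub>v f | h f. True}) \<subseteq> ?Z"
    by (rule closure_minimal)
  then have "?Z = UNIV"
    unfolding closure_cspan_tensor_l2 by blast
  then show "S = T"
    by (intro blinfun_eqI) blast
qed (use T in blast)

text \<open>The norm-closed span of the \<open>x \<otimes> k\<close>, i.e. the minimal tensor product of \<open>X\<close> and
  \<open>\<K>(\<ell>\<^sup>2)\<close>.\<close>

definition tensor_compact ::
    "('a :: chilbert_space \<Rightarrow>\<^sub>L 'b :: chilbert_space) set \<Rightarrow> ('a l2 \<Rightarrow>\<^sub>L 'b l2) set"
  where "tensor_compact X = closure (cspan {op_tensor x k | x k. x \<in> X \<and> k \<in> compact_operators})"

section \<open>Ternary rings of operators\<close>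

definition acts_nondegenerately :: "('a :: chilbert_space \<Rightarrow>\<^sub>L 'b :: chilbert_space) set \<Rightarrow> bool"
  where "acts_nondegenerately X \<longleftrightarrow>
    closure (cspan {blinfun_apply x h | x h. x \<in> X}) = UNIV \<and>
    closure (cspan {blinfun_apply (cadjoint x) k | x k. x \<in> X}) = UNIV"

definition TRO :: "('a :: chilbert_space \<Rightarrow>\<^sub>L 'b :: chilbert_space) set \<Rightarrow> bool"
  where "TRO M \<longleftrightarrow> M \<subseteq> cblin \<and> csubspace M \<and>
    (\<forall>a\<in>M. \<forall>b\<in>M. \<forall>c\<in>M. a o\<^sub>L cadjoint b o\<^sub>L c \<in> M)"

definition sigma_TRO :: "('a :: chilbert_space \<Rightarrow>\<^sub>L 'b :: chilbert_space) set \<Rightarrow> bool"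
  where "sigma_TRO M \<longleftrightarrow> TRO M \<and> closed M \<and>
    (\<exists>m n :: nat \<Rightarrow> 'a \<Rightarrow>\<^sub>L 'b. range m \<subseteq> M \<and> range n \<subseteq> M \<and>
      (\<forall>k. norm (\<Sum>i\<le>k. cadjoint (m i) o\<^sub>L m i) \<le> 1) \<and>
      (\<forall>k. norm (\<Sum>i\<le>k. n i o\<^sub>L cadjoint (n i)) \<le> 1) \<and>
      (\<forall>x\<in>M. (\<lambda>k. x o\<^sub>L cadjoint (m k) o\<^sub>L m k) sums x) \<and>
      (\<forall>x\<in>M. (\<lambda>k. n k o\<^sub>L cadjoint (n k) o\<^sub>L x) sums x))"

definition sigma_strongly_TRO_equivalent ::
    "('h1 :: chilbert_space \<Rightarrow>\<^sub>L 'h2 :: chilbert_space) set \<Rightarrow>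
     ('k1 :: chilbert_space \<Rightarrow>\<^sub>L 'k2 :: chilbert_space) set \<Rightarrow> bool"
  where "sigma_strongly_TRO_equivalent X Y \<longleftrightarrow>
    (\<exists>(M1 :: ('h1 \<Rightarrow>\<^sub>L 'k1) set) (M2 :: ('h2 \<Rightarrow>\<^sub>L 'k2) set).
      sigma_TRO M1 \<and> sigma_TRO M2 \<and>
      X = closure (cspan {cadjoint b o\<^sub>L y o\<^sub>L a | a b y. a \<in> M1 \<and> b \<in> M2 \<and> y \<in> Y}) \<and>
      Y = closure (cspan {b o\<^sub>L x o\<^sub>L cadjoint a | a b x. a \<in> M1 \<and> b \<in> M2 \<and> x \<in> X}))"

end

theory Submission
  imports Defs
begin

text \<open>A \<open>\<sigma>\<close>-TRO \<open>M \<subseteq> B(H,K)\<close> acting nondegenerately, with sequences \<open>m\<^sub>k\<close>, \<open>n\<^sub>k\<close>, gives isometries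
  \<open>S: H \<otimes> \<ell>\<^sup>2 \<rightarrow> K \<otimes> \<ell>\<^sup>2\<close> and \<open>T: K \<otimes> \<ell>\<^sup>2 \<rightarrow> H \<otimes> \<ell>\<^sup>2\<close> by \<open>(S f)\<^sub>(\<^sub>j\<^sub>,\<^sub>k\<^sub>) = m\<^sub>k f\<^sub>j\<close> and
  \<open>(T g)\<^sub>(\<^sub>j\<^sub>,\<^sub>k\<^sub>) = n\<^sub>k\<^sup>* g\<^sub>j\<close>. Splitting \<open>\<ell>\<^sup>2\<close> into even and odd coordinates, \<open>T\<close> yields a unitary
  \<open>H \<otimes> \<ell>\<^sup>2 \<cong> K \<otimes> \<ell>\<^sup>2 \<oplus> H \<otimes> \<ell>\<^sup>2\<close> and \<open>S\<close> yields a unitary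
  \<open>K \<otimes> \<ell>\<^sup>2 \<cong> H \<otimes> \<ell>\<^sup>2 \<oplus> K \<otimes> \<ell>\<^sup>2\<close>; together they give a unitary
  \<open>U: H \<otimes> \<ell>\<^sup>2 \<rightarrow> K \<otimes> \<ell>\<^sup>2\<close> that is a polynomial in \<open>S\<close>, \<open>T\<close>, the two splitting isometries and
  their adjoints. No strong limits of operators occur in \<open>U\<close>, so left multiplication by \<open>U\<close> maps
  \<open>X \<otimes> \<K>\<close> onto \<open>Z \<otimes> \<K>\<close> whenever \<open>Z = [M X]\<close> and \<open>X = [M\<^sup>* Z]\<close>. Apply this with \<open>M\<^sub>2\<close> to pass from
  \<open>X\<close> to \<open>Z = [M\<^sub>2 X]\<close>, and with \<open>M\<^sub>1\<close> to pass from \<open>Z\<^sup>*\<close> to \<open>Y\<^sup>*\<close>.\<close>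

subclass (in chilbert_space) banach ..

section \<open>Inner products and the Riesz representation\<close>

lemma cinner_scaleR_left: "cinner (r *\<^sub>R x) y = r *\<^sub>R cinner x (y :: 'a :: complex_inner)"
  by (metis cinner_scaleC_left scaleC_of_real scaleR_conv_of_real)

lemma cinner_scaleR_right: "cinner x (r *\<^sub>R y) = r *\<^sub>R cinner x (y :: 'a :: complex_inner)"
  by (metis cinner_scaleC_right complex_cnj_complex_of_real scaleC_of_real scaleR_conv_of_real)

text \<open>Cauchy-Schwarz: for nonzero vectors, normalising both turns the arithmetic-mean bound
  \<open>norm_cinner_le_half\<close> into the bound by 1.\<close>

lemma norm_cinner_le: "cmod (cinner x y) \<le> norm x * norm (y :: 'a :: complex_inner)"
proof (cases "x = 0 \<or> y = 0")
  case False
  then have "cmod (cinner x y) / (norm x * norm y)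
      = cmod (cinner (inverse (norm x) *\<^sub>R x) (inverse (norm y) *\<^sub>R y))"
    by (simp add: cinner_scaleR_left cinner_scaleR_right field_simps)
  also have "\<dots> \<le> 1"
    using False by (intro order_trans[OF norm_cinner_le_half]) simp
  finally show ?thesis
    using False by (simp add: field_simps)
qed auto

lemma bounded_bilinear_cinner: "bounded_bilinear (cinner :: 'a :: complex_inner \<Rightarrow> 'a \<Rightarrow> complex)"
  by (rule bounded_bilinear.intro)
    (auto simp: cinner_add_left cinner_add_right cinner_scaleR_left cinner_scaleR_right
      intro!: exI[of _ 1] norm_cinner_le)

lemmas cinner_sum_left = bounded_bilinear.sum_left[OF bounded_bilinear_cinner]
lemmas cinner_sum_right = bounded_bilinear.sum_right[OF bounded_bilinear_cinner]

lemma Re_cinner_commute: "Re (cinner x y) = Re (cinner y (x :: 'a :: complex_inner))"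
  by (subst cinner_commute) simp

lemma norm_sq_eq: "(norm x)\<^sup>2 = Re (cinner x (x :: 'a :: complex_inner))"
  by (simp add: cinner_self)

lemma norm_add_sq:
  "(norm (x + y))\<^sup>2 = (norm x)\<^sup>2 + (norm y)\<^sup>2 + 2 * Re (cinner x (y :: 'a :: complex_inner))"
  by (simp add: norm_sq_eq cinner_add_left cinner_add_right Re_cinner_commute[of y x])

lemma norm_diff_sq:
  "(norm (x - y))\<^sup>2 = (norm x)\<^sup>2 + (norm y)\<^sup>2 - 2 * Re (cinner x (y :: 'a :: complex_inner))"
  using norm_add_sq[of x "- y"] by (simp add: cinner_minus_right)

text \<open>The representing vector is the minimizer of \<open>y \<mapsto> \<parallel>y\<parallel>\<^sup>2 - 2 Re (f y)\<close>.\<close>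

lemma riesz_representation:
  fixes f :: "'a :: chilbert_space \<Rightarrow> complex"
  assumes f: "bounded_linear f" and fC: "\<And>c x. f (c *\<^sub>C x) = c * f x"
  shows "\<exists>z. \<forall>x. f x = cinner x z"
proof -
  interpret f: bounded_linear f by fact
  define q where "q y = (norm y)\<^sup>2 - 2 * Re (f y)" for y
  obtain B where B: "\<And>y. norm (f y) \<le> norm y * B"
    using f.bounded by blast
  \<comment> \<open>Completing the square: \<open>q y\<close> is at least
    \<open>(norm y - B)^2 - B^2\<close>.\<close>
  have q_ge: "- B\<^sup>2 \<le> q y" for y
  proof -
    have "Re (f y) \<le> norm y * B"
      using B[of y] complex_Re_le_cmod[of "f y"] by linarith
    then show ?thesis
      using zero_le_power2[of "norm y - B"] by (simp add: q_def power2_eq_square algebra_simps)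
  qed
  then have bdd: "bdd_below (range q)"
    by (intro bdd_belowI2)
  define d where "d = Inf (range q)"
  have d_le: "d \<le> q y" for y
    unfolding d_def by (rule cInf_lower[OF _ bdd]) simp
  have "\<exists>x. q x < d + inverse (real (Suc n))" for n
    using cInf_lessD[of "range q" "d + inverse (real (Suc n))"] by (auto simp: d_def)
  then obtain X where X: "\<And>n. q (X n) < d + inverse (real (Suc n))"
    by metis
  \<comment> \<open>The linear terms of \<open>q\<close> cancel, so this is the parallelogram law.
    Since \<open>q\<close> is at least \<open>d\<close> at the midpoint, two near-minimizers must be
    close to each other.\<close>
  have parallelogram: "(norm (x - y))\<^sup>2 = 2 * q x + 2 * q y - 4 * q ((1/2) *\<^sub>R (x + y))" for x y
  proof -
    have "4 * q ((1/2) *\<^sub>R (x + y)) = (norm (x + y))\<^sup>2 - 4 * Re (f x) - 4 * Re (f y)"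
      unfolding q_def f.scaleR f.add norm_scaleR power_mult_distrib
      by (simp add: power2_eq_square algebra_simps)
    then show ?thesis
      by (simp add: q_def norm_add_sq norm_diff_sq)
  qed
  have "Cauchy X"
  proof (rule CauchyI)
    fix e :: real assume "e > 0"
    then obtain N where N: "inverse (real (Suc N)) < e\<^sup>2 / 4"
      using reals_Archimedean[of "e\<^sup>2 / 4"] by auto
    show "\<exists>M. \<forall>m\<ge>M. \<forall>n\<ge>M. norm (X m - X n) < e"
    proof (intro exI allI impI)
      fix m n assume mn: "m \<ge> N" "n \<ge> N"
      have le: "inverse (real (Suc k)) \<le> inverse (real (Suc N))" if "k \<ge> N" for k
        using that by (simp add: le_imp_inverse_le)
      have "(norm (X m - X n))\<^sup>2 \<le> 2 * q (X m) + 2 * q (X n) - 4 * d"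
        unfolding parallelogram using d_le[of "(1/2) *\<^sub>R (X m + X n)"] by simp
      also have "\<dots> < e\<^sup>2"
        using X[of m] X[of n] le[OF mn(1)] le[OF mn(2)] N by linarith
      finally show "norm (X m - X n) < e"
        using \<open>e > 0\<close> by (simp add: power_less_imp_less_base)
    qed
  qed
  then obtain z where z: "X \<longlonglongrightarrow> z"
    using Cauchy_convergent_iff convergent_def by blast
  have "(\<lambda>n. q (X n)) \<longlonglongrightarrow> q z"
    unfolding q_def by (intro tendsto_intros z f.tendsto)
  moreover have "(\<lambda>n. d + inverse (real (Suc n))) \<longlonglongrightarrow> d + 0"
    by (intro tendsto_intros LIMSEQ_inverse_real_of_nat)
  ultimately have qz: "q z \<le> d"
    by (rule LIMSEQ_le[THEN order_trans]) (use X in \<open>auto intro: less_imp_le exI[of _ 0]\<close>)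
  have Re_eq: "Re (f y) = Re (cinner y z)" for y
  proof -
    \<comment> \<open>Half the derivative of \<open>q\<close> at the minimizer \<open>z\<close> in
      the direction \<open>y\<close>; it has to vanish.\<close>
    define s where "s = Re (cinner z y) - Re (f y)"
    have quad: "0 \<le> t\<^sup>2 * (norm y)\<^sup>2 + 2 * t * s" for t
    proof -
      have "q z \<le> q (z + t *\<^sub>R y)"
        using qz d_le order_trans by blast
      then show ?thesis
        by (simp add: s_def q_def norm_add_sq f.add f.scaleR cinner_scaleR_right power_mult_distrib
            algebra_simps)
    qed
    have "s = 0"
    proof (cases "y = 0")
      case True
      then show ?thesis by (simp add: s_def f.zero)
    next
      case False
      define N where "N = (norm y)\<^sup>2"
      have "N > 0"
        using False by (simp add: N_def)
      \<comment> \<open>The quadratic in \<open>t\<close> is evaluated at its minimum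
        \<open>t = - s / N\<close>, where its value is \<open>- s^2 / N\<close>.\<close>
      then have "0 \<le> - (s\<^sup>2 / N)"
        using quad[of "- s / N", folded N_def] by (simp add: power2_eq_square field_simps)
      then show ?thesis
        using \<open>N > 0\<close> by (simp add: divide_le_0_iff)
    qed
    then show ?thesis by (simp add: s_def Re_cinner_commute)
  qed
  \<comment> \<open>Complex linearity recovers the imaginary part at \<open>x\<close> from the real
    part at \<open>\<i> *\<^sub>C x\<close>.\<close>
  have "f x = cinner x z" for x
    using Re_eq[of x] Re_eq[of "\<i> *\<^sub>C x"]
    by (simp add: fC cinner_scaleC_left complex_eq_iff)
  then show ?thesis by blast
qed

lemma cinner_eqI:
  fixes u v :: "'a :: complex_inner"
  assumes "\<And>x. cinner x u = cinner x v"
  shows "u = v"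
  using eq_0_if_cinner_eq_0[of "u - v"] assms by (simp add: cinner_diff_right)

section \<open>Adjoints\<close>

lemma cblinD: "T \<in> cblin \<Longrightarrow> blinfun_apply T (c *\<^sub>C x) = c *\<^sub>C blinfun_apply T x"
  by (simp add: cblin_def)

lemma cblin_compose [intro, simp]: "S \<in> cblin \<Longrightarrow> T \<in> cblin \<Longrightarrow> S o\<^sub>L T \<in> cblin"
  by (simp add: cblin_def)

lemma cblin_id [intro, simp]: "id_blinfun \<in> cblin"
  by (simp add: cblin_def)

lemma cblin_add [intro, simp]: "S \<in> cblin \<Longrightarrow> T \<in> cblin \<Longrightarrow> S + T \<in> cblin"
  and cblin_diff [intro, simp]: "S \<in> cblin \<Longrightarrow> T \<in> cblin \<Longrightarrow> S - T \<in> cblin"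
  and cblin_scaleC [intro, simp]: "T \<in> cblin \<Longrightarrow> c *\<^sub>C T \<in> cblin"
  and cblin_zero [intro, simp]: "0 \<in> cblin"
  and cblin_sum: "(\<And>i. i \<in> I \<Longrightarrow> g i \<in> cblin) \<Longrightarrow> sum g I \<in> cblin"
  using csubspace_cblin
  by (auto intro: complex_vector.subspace_add complex_vector.subspace_diff
      complex_vector.subspace_scale complex_vector.subspace_0 complex_vector.subspace_sum)

lemma closed_cblin: "closed cblin"
  unfolding cblin_def
  by (intro closed_Collect_all closed_Collect_eq continuous_intros
      bounded_linear.continuous_on[OF bounded_linear_scaleC])

text \<open>Supplies the existence behind the definite description in \<open>cadjoint\<close>. For
  each \<open>y\<close> the functional \<open>cinner (T x) y\<close> of \<open>x\<close> is
  represented by a vector; it is complex-linear because \<open>T\<close> is, which is why the facts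
  on adjoints carry the hypothesis \<open>T \<in> cblin\<close>.\<close>

lemma cadjoint_ex:
  fixes T :: "'a :: chilbert_space \<Rightarrow>\<^sub>L 'b :: chilbert_space"
  assumes T: "T \<in> cblin"
  shows "\<exists>S \<in> cblin. \<forall>x y. cinner (blinfun_apply T x) y = cinner x (blinfun_apply S y)"
proof -
  have "\<exists>z. \<forall>x. cinner (blinfun_apply T x) y = cinner x z" for y
  proof (rule riesz_representation)
    show "bounded_linear (\<lambda>x. cinner (blinfun_apply T x) y)"
      using bounded_linear_compose[OF bounded_bilinear.bounded_linear_left[OF bounded_bilinear_cinner]
          blinfun.bounded_linear_right] .
  qed (simp add: cblinD[OF T] cinner_scaleC_left)
  then obtain S where S: "\<And>x y. cinner (blinfun_apply T x) y = cinner x (S y)"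
    by metis
  have eqI: "u = v" if "\<And>x. cinner x u = cinner x v" for u v :: 'a
    using eq_0_if_cinner_eq_0[of "u - v"] that by (simp add: cinner_diff_right)
  have SC: "S (c *\<^sub>C y) = c *\<^sub>C S y" for c y
    by (rule eqI) (simp add: S[symmetric] cinner_scaleC_right)
  have bl: "bounded_linear S"
  proof (rule bounded_linear_intro[where K = "norm T"])
    show "S (x + y) = S x + S y" for x y
      by (rule eqI) (simp add: S[symmetric] cinner_add_right)
    show "S (r *\<^sub>R x) = r *\<^sub>R S x" for r x
      using SC[of "complex_of_real r" x] by (simp add: scaleC_of_real)
    show "norm (S y) \<le> norm y * norm T" for y
    proof (cases "S y = 0")
      case False
      have "(norm (S y))\<^sup>2 = cmod (cinner (blinfun_apply T (S y)) y)"
        by (simp add: S cinner_self norm_power)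
      also have "\<dots> \<le> norm T * norm (S y) * norm y"
        by (intro order_trans[OF norm_cinner_le] mult_right_mono norm_blinfun) simp
      finally show ?thesis
        using False by (simp add: power2_eq_square mult_ac)
    qed auto
  qed
  show ?thesis
    by (rule bexI[of _ "Blinfun S"])
      (simp_all add: bounded_linear_Blinfun_apply[OF bl] S cblin_def SC)
qed

lemma cblin_cadjoint [intro, simp]: "T \<in> cblin \<Longrightarrow> cadjoint T \<in> cblin"
  and cinner_cadjoint_right:
    "T \<in> cblin \<Longrightarrow> cinner x (blinfun_apply (cadjoint T) y) = cinner (blinfun_apply T x) y"
  using cadjoint_ex cadjoint_eqI by (metis, metis)

lemma cinner_cadjoint_left:
  "T \<in> cblin \<Longrightarrow> cinner (blinfun_apply (cadjoint T) y) x = cinner y (blinfun_apply T x)"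
  by (metis cinner_cadjoint_right cinner_commute)

lemma cadjoint_cadjoint [simp]: "T \<in> cblin \<Longrightarrow> cadjoint (cadjoint T) = T"
  by (rule cadjoint_eqI) (simp add: cinner_cadjoint_left)

lemma cadjoint_compose [simp]:
  "S \<in> cblin \<Longrightarrow> T \<in> cblin \<Longrightarrow> cadjoint (S o\<^sub>L T) = cadjoint T o\<^sub>L cadjoint S"
  by (rule cadjoint_eqI) (simp add: cinner_cadjoint_right)

lemma cadjoint_id [simp]: "cadjoint id_blinfun = id_blinfun"
  by (rule cadjoint_eqI) simp

lemma cadjoint_zero [simp]: "cadjoint 0 = 0"
  by (rule cadjoint_eqI) simp

lemma cadjoint_add [simp]:
  "S \<in> cblin \<Longrightarrow> T \<in> cblin \<Longrightarrow> cadjoint (S + T) = cadjoint S + cadjoint T"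
  by (rule cadjoint_eqI)
    (simp add: blinfun.add_left cinner_add_left cinner_add_right cinner_cadjoint_right)

lemma cadjoint_diff [simp]:
  "S \<in> cblin \<Longrightarrow> T \<in> cblin \<Longrightarrow> cadjoint (S - T) = cadjoint S - cadjoint T"
  by (rule cadjoint_eqI)
    (simp add: blinfun.diff_left cinner_diff_left cinner_diff_right cinner_cadjoint_right)

lemma cadjoint_scaleC [simp]: "T \<in> cblin \<Longrightarrow> cadjoint (c *\<^sub>C T) = cnj c *\<^sub>C cadjoint T"
  by (rule cadjoint_eqI)
    (simp add: scaleC_blinfun.rep_eq cinner_scaleC_left cinner_scaleC_right cinner_cadjoint_right)

lemma cadjoint_sum:
  "(\<And>i. i \<in> I \<Longrightarrow> g i \<in> cblin) \<Longrightarrow> cadjoint (sum g I) = (\<Sum>i\<in>I. cadjoint (g i))"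
  by (induction I rule: infinite_finite_induct) (simp_all add: cblin_sum)

lemma norm_cadjoint [simp]:
  assumes "T \<in> cblin"
  shows "norm (cadjoint T) = norm T"
proof -
  \<comment> \<open>Stated at fresh types, so that it applies both to \<open>T\<close> and to
    \<open>cadjoint T\<close>.\<close>
  have le: "norm (cadjoint S) \<le> norm S" if S: "S \<in> cblin"
    for S :: "'c :: chilbert_space \<Rightarrow>\<^sub>L 'd :: chilbert_space"
  proof (rule norm_blinfun_bound)
    fix y
    let ?z = "blinfun_apply (cadjoint S) y"
    show "norm ?z \<le> norm S * norm y"
    proof (cases "?z = 0")
      case False
      have "(norm ?z)\<^sup>2 = cmod (cinner ?z ?z)"
        by (simp add: cinner_self norm_power)
      also have "\<dots> = cmod (cinner (blinfun_apply S ?z) y)"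
        by (simp add: cinner_cadjoint_right S)
      also have "\<dots> \<le> norm S * norm ?z * norm y"
        by (intro order_trans[OF norm_cinner_le] mult_right_mono norm_blinfun) simp
      finally show ?thesis
        using False by (simp add: power2_eq_square mult_ac)
    qed simp
  qed simp
  show ?thesis
    using le[OF assms] le[OF cblin_cadjoint[OF assms]] assms by simp
qed

text \<open>Additivity and isometry of \<open>cadjoint\<close> are available on \<open>cblin\<close>
  only, so the partial sums are compared through their norms and not through a bounded linear map on
  the whole operator type.\<close>

lemma sums_cadjoint:
  assumes "\<And>n. f n \<in> cblin" "f sums T" "T \<in> cblin"
  shows "(\<lambda>n. cadjoint (f n)) sums cadjoint T"
proof -
  have "cadjoint (\<Sum>i<n. f i) = (\<Sum>i<n. cadjoint (f i))" for n
    by (induction n) (simp_all add: assms(1) cblin_sum)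
  then have "norm ((\<Sum>i<n. cadjoint (f i)) - cadjoint T) = norm ((\<Sum>i<n. f i) - T)" for n
    using assms by (metis cadjoint_diff cblin_diff cblin_sum norm_cadjoint)
  then show ?thesis
    using assms(2) by (simp add: sums_def tendsto_iff dist_norm)
qed

section \<open>Closed subspaces\<close>

lemma csubspace_closure:
  fixes S :: "'a :: complex_normed_vector set"
  assumes "csubspace S"
  shows "csubspace (closure S)"
proof (rule complex_vector.subspaceI)
  show "0 \<in> closure S"
    using assms closure_subset complex_vector.subspace_0 by blast
  show "x + y \<in> closure S" if xy: "x \<in> closure S" "y \<in> closure S" for x y
  proof -
    obtain u v where "\<forall>n. u n \<in> S" "u \<longlonglongrightarrow> x" "\<forall>n. v n \<in> S" "v \<longlonglongrightarrow> y"
      using xy unfolding closure_sequential by blast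
    then show ?thesis
      unfolding closure_sequential
      by (intro exI[of _ "\<lambda>n. u n + v n"]) (auto intro: tendsto_add complex_vector.subspace_add[OF assms])
  qed
  show "c *\<^sub>C x \<in> closure S" if x: "x \<in> closure S" for c x
  proof -
    obtain u where "\<forall>n. u n \<in> S" "u \<longlonglongrightarrow> x"
      using x unfolding closure_sequential by blast
    then show ?thesis
      unfolding closure_sequential
      by (intro exI[of _ "\<lambda>n. c *\<^sub>C u n"])
        (auto intro: bounded_linear.tendsto[OF bounded_linear_scaleC] complex_vector.subspace_scale[OF assms])
  qed
qed

lemma csubspace_closure_cspan: "csubspace (closure (cspan (G :: 'a :: complex_normed_vector set)))"
  by (intro csubspace_closure complex_vector.subspace_span)

lemma closure_cspan_base: "x \<in> G \<Longrightarrow> x \<in> closure (cspan G)"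
  by (rule subsetD[OF closure_subset]) (rule complex_vector.span_base)

lemma closure_cspan_minimal:
  "G \<subseteq> S \<Longrightarrow> csubspace S \<Longrightarrow> closed S \<Longrightarrow> closure (cspan G) \<subseteq> S"
  by (intro closure_minimal complex_vector.span_minimal)

lemma closed_csubspace_vimage:
  assumes "bounded_linear f" "\<And>c x. f (c *\<^sub>C x) = c *\<^sub>C f x" "csubspace S" "closed S"
  shows "csubspace (f -` S)" "closed (f -` S)"
proof -
  interpret bounded_linear f by fact
  show "csubspace (f -` S)"
    using assms(2,3) by (auto simp: complex_vector.subspace_def zero add)
  show "closed (f -` S)"
    by (rule continuous_closed_vimage[OF assms(4)]) (rule linear_continuous_at[OF assms(1)])
qed

text \<open>Induction over a closed span: the preimage of a closed subspace is a closed subspace, so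
  it contains the closed span once it contains the generators.\<close>

lemma closure_cspan_image_subset:
  assumes "bounded_linear f" "\<And>c x. f (c *\<^sub>C x) = c *\<^sub>C f x" "csubspace S" "closed S"
    and "\<And>x. x \<in> G \<Longrightarrow> f x \<in> S" "x \<in> closure (cspan G)"
  shows "f x \<in> S"
proof -
  have "closure (cspan G) \<subseteq> f -` S"
    using assms by (intro closure_cspan_minimal closed_csubspace_vimage) auto
  then show ?thesis using assms(6) by blast
qed

lemma blinfun_compose_scaleC_left: "(c *\<^sub>C S) o\<^sub>L T = c *\<^sub>C (S o\<^sub>L T)"
  by (rule blinfun_eqI) (simp add: scaleC_blinfun.rep_eq)

lemma blinfun_compose_scaleC_right: "S \<in> cblin \<Longrightarrow> S o\<^sub>L (c *\<^sub>C T) = c *\<^sub>C (S o\<^sub>L T)"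
  by (rule blinfun_eqI) (simp add: scaleC_blinfun.rep_eq cblinD)

lemmas blinfun_compose_add_left = bounded_bilinear.add_left[OF bounded_bilinear_blinfun_compose]
lemmas blinfun_compose_add_right = bounded_bilinear.add_right[OF bounded_bilinear_blinfun_compose]
lemmas blinfun_compose_diff_left = bounded_bilinear.diff_left[OF bounded_bilinear_blinfun_compose]
lemmas blinfun_compose_diff_right = bounded_bilinear.diff_right[OF bounded_bilinear_blinfun_compose]

lemma blinfun_compose_assoc: "(R o\<^sub>L S) o\<^sub>L T = R o\<^sub>L (S o\<^sub>L T)"
  by (rule blinfun_eqI) simp

lemma blinfun_compose_id [simp]: "id_blinfun o\<^sub>L T = T" "T o\<^sub>L id_blinfun = T"
  by (auto intro: blinfun_eqI)

lemmas blinfun_compose_zero [simp] =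
  bounded_bilinear.zero_left[OF bounded_bilinear_blinfun_compose]
  bounded_bilinear.zero_right[OF bounded_bilinear_blinfun_compose]

lemmas blinfun_compose_distribs = blinfun_compose_add_left blinfun_compose_add_right
  blinfun_compose_diff_left blinfun_compose_diff_right

lemma closure_cspan_compose_left:
  assumes "S \<in> cblin" "csubspace Z" "closed Z"
    and "\<And>T. T \<in> G \<Longrightarrow> S o\<^sub>L T \<in> Z" "T \<in> closure (cspan G)"
  shows "S o\<^sub>L T \<in> Z"
  using closure_cspan_image_subset[OF bounded_bilinear.bounded_linear_right[OF
        bounded_bilinear_blinfun_compose] blinfun_compose_scaleC_right[OF assms(1)]] assms(2-)
  by blast

lemma closure_cspan_compose_right:
  assumes "csubspace Z" "closed Z"
    and "\<And>T. T \<in> G \<Longrightarrow> T o\<^sub>L S \<in> Z" "T \<in> closure (cspan G)"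
  shows "T o\<^sub>L S \<in> Z"
  using closure_cspan_image_subset[OF bounded_bilinear.bounded_linear_left[OF
        bounded_bilinear_blinfun_compose] blinfun_compose_scaleC_left] assms
  by blast

lemma closure_cspan_apply:
  assumes "csubspace Z" "closed Z"
    and "\<And>T. T \<in> G \<Longrightarrow> blinfun_apply T x \<in> Z" "T \<in> closure (cspan G)"
  shows "blinfun_apply T x \<in> Z"
  by (rule closure_cspan_image_subset[where f = "\<lambda>T. blinfun_apply T x" and G = G])
    (use assms in \<open>auto simp: scaleC_blinfun.rep_eq intro: blinfun.bounded_linear_left\<close>)

lemma closure_cspan_subset_cblin: "G \<subseteq> cblin \<Longrightarrow> closure (cspan G) \<subseteq> cblin"
  by (intro closure_cspan_minimal csubspace_cblin closed_cblin)

lemma cadjoint_image_iff: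
  "S \<subseteq> cblin \<Longrightarrow> T \<in> cadjoint ` S \<longleftrightarrow> T \<in> cblin \<and> cadjoint T \<in> S"
  by (metis (no_types, lifting) cadjoint_cadjoint cblin_cadjoint image_iff subsetD)

lemma csubspace_cadjoint_image:
  assumes "S \<subseteq> cblin" "csubspace S"
  shows "csubspace (cadjoint ` S)"
  using assms csubspace_cblin
  by (auto simp: complex_vector.subspace_def cadjoint_image_iff)

lemma closed_cadjoint_image:
  assumes "S \<subseteq> cblin" "closed S"
  shows "closed (cadjoint ` S)"
  unfolding closed_sequential_limits
proof (intro allI impI, elim conjE)
  fix x l assume x: "\<forall>n. x n \<in> cadjoint ` S" "x \<longlonglongrightarrow> l"
  have xc: "x n \<in> cblin" "cadjoint (x n) \<in> S" for n
    using x(1) assms(1) by (auto simp: cadjoint_image_iff)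
  have l: "l \<in> cblin"
    by (rule closed_sequentially[OF closed_cblin xc(1) x(2)])
  have "dist (cadjoint (x n)) (cadjoint l) = dist (x n) l" for n
    using xc l by (simp add: dist_norm flip: cadjoint_diff)
  then have "(\<lambda>n. cadjoint (x n)) \<longlonglongrightarrow> cadjoint l"
    using x(2) by (simp add: tendsto_iff)
  then have "cadjoint l \<in> S"
    by (rule closed_sequentially[OF assms(2) xc(2)])
  then show "l \<in> cadjoint ` S"
    using assms(1) l by (simp add: cadjoint_image_iff)
qed

text \<open>One inclusion is minimality of the closed span. Applying it to the adjoint generators
  and taking adjoints once more gives the other.\<close>

lemma cadjoint_closure_cspan:
  assumes "G \<subseteq> cblin"
  shows "cadjoint ` closure (cspan G) = closure (cspan (cadjoint ` G))"
proof
  have sub: "closure (cspan (cadjoint ` F)) \<subseteq> cadjoint ` closure (cspan F)"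
    if "F \<subseteq> cblin" for F :: "('c :: chilbert_space \<Rightarrow>\<^sub>L 'd :: chilbert_space) set"
    using closure_cspan_base[of _ F] closure_cspan_subset_cblin[OF that]
    by (intro closure_cspan_minimal csubspace_cadjoint_image closed_cadjoint_image
        csubspace_closure_cspan) (auto simp: csubspace_cblin closed_cblin)
  show "closure (cspan (cadjoint ` G)) \<subseteq> cadjoint ` closure (cspan G)"
    by (rule sub[OF assms])
  have "cadjoint ` cadjoint ` G = G"
    using assms by (force simp: image_image)
  then have "closure (cspan G) \<subseteq> cadjoint ` closure (cspan (cadjoint ` G))"
    using sub[of "cadjoint ` G"] assms by auto
  then have "cadjoint ` closure (cspan G) \<subseteq> cadjoint ` cadjoint ` closure (cspan (cadjoint ` G))"
    by blast
  moreover have "closure (cspan (cadjoint ` G)) \<subseteq> cblin"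
    using assms by (intro closure_cspan_subset_cblin) auto
  then have "cadjoint ` cadjoint ` closure (cspan (cadjoint ` G)) = closure (cspan (cadjoint ` G))"
    by (force simp: image_image)
  ultimately show "cadjoint ` closure (cspan G) \<subseteq> closure (cspan (cadjoint ` G))"
    by simp
qed

section \<open>Coordinates in \<open>\<ell>\<^sup>2\<close>\<close>

lemma l2_eqI: "(\<And>n. l2_nth f n = l2_nth g n) \<Longrightarrow> f = g"
  by (simp add: l2_nth_inject[symmetric] fun_eq_iff)

lemmas l2_nth_simps [simp] = zero_l2.rep_eq plus_l2.rep_eq minus_l2.rep_eq uminus_l2.rep_eq
  scaleC_l2.rep_eq scaleR_l2.rep_eq tensor_l2.rep_eq

lift_definition single_l2 :: "nat \<Rightarrow> 'a :: chilbert_space \<Rightarrow> 'a l2" is "\<lambda>n h m. if m = n then h else 0"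
  by (rule summable_finite[where N = "{_}"]) auto

lemmas l2_nth_single [simp] = single_l2.rep_eq

lemma norm_single_l2 [simp]: "norm (single_l2 n h) = norm h"
  using suminf_finite[of "{n}" "\<lambda>m. (norm (l2_nth (single_l2 n h) m))\<^sup>2"]
  by (simp add: norm_l2_def)

lemma cinner_single_l2: "cinner (single_l2 n h) f = cinner h (l2_nth f n)"
  using suminf_finite[of "{n}" "\<lambda>m. cinner (l2_nth (single_l2 n h) m) (l2_nth f m)"]
  by (simp add: cinner_l2_def)

lemma cinner_single_l2_right: "cinner f (single_l2 n h) = cinner (l2_nth f n) h"
  by (metis cinner_commute cinner_single_l2)

lift_definition coord_in :: "nat \<Rightarrow> 'a :: chilbert_space \<Rightarrow>\<^sub>L 'a l2" is single_l2
  by (rule bounded_linear_intro[where K = 1]) (auto intro!: l2_eqI)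

lift_definition coord :: "nat \<Rightarrow> 'a :: chilbert_space l2 \<Rightarrow>\<^sub>L 'a" is "\<lambda>n f. l2_nth f n"
  by (rule bounded_linear_intro[where K = 1]) (auto simp: norm_nth_le_norm_l2)

lemmas coord_apply [simp] = coord_in.rep_eq coord.rep_eq

lemma coord_cblin [simp, intro]: "coord_in n \<in> cblin" "coord n \<in> cblin"
  by (auto simp: cblin_def intro!: l2_eqI)

lemma cadjoint_coord_in [simp]: "cadjoint (coord_in n) = coord n"
  by (rule cadjoint_eqI) (simp add: cinner_single_l2)

lemma cadjoint_coord [simp]: "cadjoint (coord n) = coord_in n"
  using cadjoint_cadjoint[of "coord_in n"] by simp

lemma l2_nth_sum [simp]: "l2_nth (\<Sum>i\<in>I. g i) n = (\<Sum>i\<in>I. l2_nth (g i) n)"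
  by (induction I rule: infinite_finite_induct) auto

lemma norm_l2_sq_finite:
  assumes "\<And>n. n \<ge> N \<Longrightarrow> l2_nth f n = 0"
  shows "(norm f)\<^sup>2 = (\<Sum>n<N. (norm (l2_nth f n))\<^sup>2)"
  unfolding norm_l2_sq by (rule suminf_finite) (use assms in auto)

lemma sum_norm_nth_le: "finite I \<Longrightarrow> (\<Sum>n\<in>I. (norm (l2_nth f n))\<^sup>2) \<le> (norm f)\<^sup>2"
  unfolding norm_l2_sq by (intro sum_le_suminf summable_l2) auto

lemma l2_nth_sum_single:
  "l2_nth (\<Sum>n<N. single_l2 n (g n)) m = (if m < N then g m else 0)"
  by simp

lemma sums_single_l2: "(\<lambda>n. single_l2 n (l2_nth f n)) sums f"
proof -
  let ?T = "\<lambda>N. \<Sum>n<N. single_l2 n (l2_nth f n)"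
  have "(norm (f - ?T N))\<^sup>2 = (\<Sum>n. (norm (l2_nth f (n + N)))\<^sup>2)" for N
    using suminf_split_initial_segment[OF summable_l2[of "f - ?T N"], of N]
    by (simp add: norm_l2_sq l2_nth_sum_single)
  moreover have "(\<lambda>N. \<Sum>n. (norm (l2_nth f (n + N)))\<^sup>2) \<longlonglongrightarrow> 0"
    by (rule suminf_exist_split2[OF summable_l2])
  ultimately have "(\<lambda>N. (norm (f - ?T N))\<^sup>2) \<longlonglongrightarrow> 0"
    by simp
  from tendsto_real_sqrt[OF this] have "(\<lambda>N. norm (?T N - f)) \<longlonglongrightarrow> 0"
    by (simp add: norm_minus_commute)
  then show ?thesis
    by (simp add: sums_def LIM_zero_cancel tendsto_norm_zero_iff)
qed

lemma blinfun_l2_eqI: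
  assumes "\<And>n h. blinfun_apply S (single_l2 n h) = blinfun_apply T (single_l2 n h)"
  shows "S = T"
proof (rule blinfun_eqI)
  fix f
  have "(\<lambda>n. blinfun_apply S (single_l2 n (l2_nth f n))) sums blinfun_apply S f"
    "(\<lambda>n. blinfun_apply T (single_l2 n (l2_nth f n))) sums blinfun_apply T f"
    by (intro bounded_linear.sums[OF blinfun.bounded_linear_right] sums_single_l2)+
  then show "blinfun_apply S f = blinfun_apply T f"
    unfolding assms by (rule sums_unique2)
qed

definition truncate :: "nat \<Rightarrow> 'a :: chilbert_space l2 \<Rightarrow>\<^sub>L 'a l2"
  where "truncate N = (\<Sum>n<N. coord_in n o\<^sub>L coord n)"

lemma truncate_apply: "blinfun_apply (truncate N) f = (\<Sum>n<N. single_l2 n (l2_nth f n))"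
  by (simp add: truncate_def blinfun.sum_left)

lemma l2_nth_truncate [simp]:
  "l2_nth (blinfun_apply (truncate N) f) n = (if n < N then l2_nth f n else 0)"
  by (simp add: truncate_apply l2_nth_sum_single)

lemma truncate_cblin [simp, intro]: "truncate N \<in> cblin"
  unfolding truncate_def by (intro cblin_sum cblin_compose coord_cblin)

lemma truncate_tendsto: "(\<lambda>N. blinfun_apply (truncate N) f) \<longlonglongrightarrow> f"
  unfolding truncate_apply using sums_single_l2 by (simp add: sums_def)

lemma norm_truncate_apply_le: "norm (blinfun_apply (truncate N) f) \<le> norm f"
proof -
  have "(norm (blinfun_apply (truncate N) f))\<^sup>2 = (\<Sum>n<N. (norm (l2_nth f n))\<^sup>2)"
    by (subst norm_l2_sq_finite[where N = N]) auto
  also have "\<dots> \<le> (norm f)\<^sup>2"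
    by (rule sum_norm_nth_le) simp
  finally show ?thesis
    by (rule power2_le_imp_le) simp
qed

lemma norm_truncate_le: "norm (truncate N) \<le> 1"
  by (rule norm_blinfun_bound) (simp_all add: norm_truncate_apply_le)

lemma cadjoint_truncate [simp]: "cadjoint (truncate N) = truncate N"
  unfolding truncate_def by (subst cadjoint_sum) simp_all

section \<open>The generators of \<open>X \<otimes> \<K>\<close>\<close>

definition orthonormal_upto :: "nat \<Rightarrow> (nat \<Rightarrow> 'a :: complex_inner) \<Rightarrow> bool"
  where "orthonormal_upto m e \<longleftrightarrow> (\<forall>k<m. \<forall>l<m. cinner (e k) (e l) = (if k = l then 1 else 0))"

lemma orthonormal_upto_cinner_sum:
  assumes "orthonormal_upto m e" "k < m"
  shows "cinner (\<Sum>l<m. a l *\<^sub>C e l) (e k) = a k"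
proof -
  have "cinner (\<Sum>l<m. a l *\<^sub>C e l) (e k) = (\<Sum>l<m. if l = k then a l else 0)"
    using assms unfolding cinner_sum_left
    by (intro sum.cong) (auto simp: cinner_scaleC_left orthonormal_upto_def)
  then show ?thesis using assms(2) by simp
qed

lemma orthonormal_upto_norm_sq:
  assumes "orthonormal_upto m e"
  shows "(norm (\<Sum>l<m. a l *\<^sub>C e l))\<^sup>2 = (\<Sum>l<m. (cmod (a l))\<^sup>2)"
proof -
  have "complex_of_real ((norm (\<Sum>l<m. a l *\<^sub>C e l))\<^sup>2)
      = (\<Sum>k<m. cnj (a k) * cinner (\<Sum>l<m. a l *\<^sub>C e l) (e k))"
    unfolding cinner_self[symmetric]
    by (subst cinner_sum_right) (simp add: cinner_scaleC_right)
  also have "\<dots> = (\<Sum>k<m. complex_of_real ((cmod (a k))\<^sup>2))"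
    by (intro sum.cong refl)
      (simp add: orthonormal_upto_cinner_sum[OF assms] complex_norm_square mult.commute del: of_real_power)
  finally show ?thesis
    by (simp only: of_real_eq_iff of_real_sum[symmetric])
qed

text \<open>Gram-Schmidt without an independence assumption: a vector whose residual
  \<open>r\<close> vanishes adds no basis vector, so \<open>m\<close> may be smaller than
  \<open>N\<close>.\<close>

lemma gram_schmidt:
  fixes h :: "nat \<Rightarrow> 'a :: complex_inner"
  shows "\<exists>m e d. orthonormal_upto m e \<and> (\<forall>j<N. h j = (\<Sum>l<m. d j l *\<^sub>C e l))"
proof (induction N)
  case 0
  show ?case by (rule exI[of _ 0]) (simp add: orthonormal_upto_def)
next
  case (Suc N)
  then obtain m e d where e: "orthonormal_upto m e"
    and d: "\<And>j. j < N \<Longrightarrow> h j = (\<Sum>l<m. d j l *\<^sub>C e l)"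
    by metis
  define p where "p = (\<Sum>l<m. cinner (h N) (e l) *\<^sub>C e l)"
  define r where "r = h N - p"
  have r: "cinner r (e k) = 0" if "k < m" for k
    using orthonormal_upto_cinner_sum[OF e that, of "\<lambda>l. cinner (h N) (e l)"]
    by (simp add: r_def p_def cinner_diff_left)
  show ?case
  proof (cases "r = 0")
    case True
    then have "h N = p" by (simp add: r_def)
    then show ?thesis
      using d e unfolding p_def
      by (intro exI[of _ m] exI[of _ e] exI[of _ "d(N := \<lambda>l. cinner (h N) (e l))"])
        (auto simp: less_Suc_eq)
  next
    case False
    define e' where "e' = e(m := inverse (norm r) *\<^sub>R r)"
    have "cinner (e k) r = 0" if "k < m" for k
      by (subst cinner_commute) (simp add: r[OF that])
    then have "orthonormal_upto (Suc m) e'"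
      using e False r unfolding orthonormal_upto_def e'_def
      by (auto simp: less_Suc_eq cinner_scaleR_left cinner_scaleR_right cinner_self
          scaleR_conv_of_real power2_eq_square field_simps)
    moreover have "(\<Sum>l<Suc m. (if l < m then a l else b) *\<^sub>C e' l)
        = (\<Sum>l<m. a l *\<^sub>C e l) + b *\<^sub>C (inverse (norm r) *\<^sub>R r)" for a b
      by (simp add: e'_def)
    moreover have "complex_of_real (norm r) *\<^sub>C (inverse (norm r) *\<^sub>R r) = r"
      using False by (simp add: scaleC_of_real)
    \<comment> \<open>On the new basis vector, the earlier \<open>h j\<close> get coefficient 0 and
      \<open>h N\<close> gets \<open>norm r\<close>; its other coefficients are those of the
      projection \<open>p\<close>.\<close>
    ultimately show ?thesis
      using d
      by (intro exI[of _ "Suc m"] exI[of _ e']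
          exI[of _ "\<lambda>j l. if l < m then (if j < N then d j l else cinner (h N) (e l))
            else (if j < N then 0 else complex_of_real (norm r))"])
        (auto simp: less_Suc_eq p_def r_def)
  qed
qed

text \<open>The operator \<open>x \<otimes> c\<close>, where \<open>c\<close> is cut off to its upper left \<open>N \<times> N\<close> corner.\<close>

definition amp ::
    "(nat \<Rightarrow> nat \<Rightarrow> complex) \<Rightarrow> nat \<Rightarrow> ('a :: chilbert_space \<Rightarrow>\<^sub>L 'b :: chilbert_space) \<Rightarrow> 'a l2 \<Rightarrow>\<^sub>L 'b l2"
  where "amp c N x = (\<Sum>i<N. \<Sum>j<N. c i j *\<^sub>C (coord_in i o\<^sub>L x o\<^sub>L coord j))"

lemma l2_nth_amp [simp]:
  "l2_nth (blinfun_apply (amp c N x) f) i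
    = (if i < N then \<Sum>j<N. c i j *\<^sub>C blinfun_apply x (l2_nth f j) else 0)"
proof -
  have "l2_nth (blinfun_apply (amp c N x) f) i
      = (\<Sum>i'<N. \<Sum>j<N. c i' j *\<^sub>C (if i = i' then blinfun_apply x (l2_nth f j) else 0))"
    by (simp add: amp_def blinfun.sum_left scaleC_blinfun.rep_eq)
  also have "\<dots> = (\<Sum>i'<N. if i' = i then \<Sum>j<N. c i j *\<^sub>C blinfun_apply x (l2_nth f j) else 0)"
    by (intro sum.cong refl) auto
  finally show ?thesis by simp
qed

text \<open>Expanding the vectors \<open>x f\<^sub>j\<close> in an orthonormal system reduces the estimate to the action of the
  scalar matrix on the columns of coefficients.\<close>

lemma norm_amp_le:
  fixes x :: "'a :: chilbert_space \<Rightarrow>\<^sub>L 'b :: chilbert_space"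
  shows "norm (amp c N x) \<le> norm (amp c N (id_blinfun :: complex \<Rightarrow>\<^sub>L complex)) * norm x"
proof (rule norm_blinfun_bound)
  fix f
  let ?M = "amp c N (id_blinfun :: complex \<Rightarrow>\<^sub>L complex)"
  define h where "h j = blinfun_apply x (l2_nth f j)" for j
  obtain m e d where e: "orthonormal_upto m e" and d: "\<And>j. j < N \<Longrightarrow> h j = (\<Sum>l<m. d j l *\<^sub>C e l)"
    using gram_schmidt by metis
  define v where "v l = (\<Sum>j<N. single_l2 j (d j l))" for l
  have v: "l2_nth (v l) j = (if j < N then d j l else 0)" for j l
    by (simp add: v_def)
  have nv: "(norm (v l))\<^sup>2 = (\<Sum>j<N. (cmod (d j l))\<^sup>2)" for l
    by (subst norm_l2_sq_finite[where N = N]) (auto simp: v)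
  have "(norm (blinfun_apply (amp c N x) f))\<^sup>2 = (\<Sum>i<N. (norm (\<Sum>j<N. c i j *\<^sub>C h j))\<^sup>2)"
    by (subst norm_l2_sq_finite[where N = N]) (auto simp: h_def)
  also have "\<dots> = (\<Sum>i<N. \<Sum>l<m. (cmod (\<Sum>j<N. c i j * d j l))\<^sup>2)"
  proof (rule sum.cong[OF refl])
    fix i
    have "(\<Sum>j<N. c i j *\<^sub>C h j) = (\<Sum>j<N. \<Sum>l<m. (c i j * d j l) *\<^sub>C e l)"
      by (intro sum.cong refl) (simp add: d complex_vector.scale_sum_right)
    also have "\<dots> = (\<Sum>l<m. (\<Sum>j<N. c i j * d j l) *\<^sub>C e l)"
      by (subst sum.swap) (simp add: complex_vector.scale_sum_left)
    finally show "(norm (\<Sum>j<N. c i j *\<^sub>C h j))\<^sup>2 = (\<Sum>l<m. (cmod (\<Sum>j<N. c i j * d j l))\<^sup>2)"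
      by (simp add: orthonormal_upto_norm_sq[OF e])
  qed
  also have "\<dots> = (\<Sum>l<m. \<Sum>i<N. (cmod (\<Sum>j<N. c i j * d j l))\<^sup>2)"
    by (rule sum.swap)
  also have "\<dots> = (\<Sum>l<m. (norm (blinfun_apply ?M (v l)))\<^sup>2)"
    by (intro sum.cong refl, subst norm_l2_sq_finite[where N = N])
      (auto simp: v scaleC_complex_def)
  also have "\<dots> \<le> (\<Sum>l<m. (norm ?M * norm (v l))\<^sup>2)"
    by (intro sum_mono power_mono norm_blinfun) simp
  also have "\<dots> = (norm ?M)\<^sup>2 * (\<Sum>l<m. \<Sum>j<N. (cmod (d j l))\<^sup>2)"
    by (simp add: power_mult_distrib nv sum_distrib_left)
  also have "\<dots> = (norm ?M)\<^sup>2 * (\<Sum>j<N. \<Sum>l<m. (cmod (d j l))\<^sup>2)"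
    by (subst sum.swap) simp
  also have "\<dots> = (norm ?M)\<^sup>2 * (\<Sum>j<N. (norm (h j))\<^sup>2)"
    by (simp add: d orthonormal_upto_norm_sq[OF e])
  also have "\<dots> \<le> (norm ?M)\<^sup>2 * (\<Sum>j<N. (norm x * norm (l2_nth f j))\<^sup>2)"
    unfolding h_def by (intro mult_left_mono sum_mono power_mono norm_blinfun) auto
  also have "\<dots> = (norm ?M * norm x)\<^sup>2 * (\<Sum>j<N. (norm (l2_nth f j))\<^sup>2)"
    by (simp add: power_mult_distrib sum_distrib_left mult_ac)
  also have "\<dots> \<le> (norm ?M * norm x)\<^sup>2 * (norm f)\<^sup>2"
    by (intro mult_left_mono sum_norm_nth_le) auto
  finally have "(norm (blinfun_apply (amp c N x) f))\<^sup>2 \<le> (norm ?M * norm x * norm f)\<^sup>2"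
    by (simp add: power_mult_distrib)
  then show "norm (blinfun_apply (amp c N x) f) \<le> norm ?M * norm x * norm f"
    by (rule power2_le_imp_le) simp
qed simp

text \<open>Padding both corners with zeros to a common size \<open>L\<close> shows that the
  difference is itself an amplified scalar matrix, so that \<open>norm_amp_le\<close> applies to
  it.\<close>

lemma amp_diff:
  assumes "M \<le> L" "N \<le> L"
  shows "amp c N x - amp c M x
    = amp (\<lambda>i j. (if i < N \<and> j < N then c i j else 0) - (if i < M \<and> j < M then c i j else 0)) L x"
    (is "_ = amp ?c' L x")
proof (rule blinfun_eqI, rule l2_eqI)
  fix f i
  have *: "(\<Sum>j<A. c i j *\<^sub>C blinfun_apply x (l2_nth f j))
      = (\<Sum>j<L. (if j < A then c i j else 0) *\<^sub>C blinfun_apply x (l2_nth f j))" if "A \<le> L" for A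
    using that by (intro sum.mono_neutral_cong_left) (auto simp: complex_vector.scale_zero_left)
  show "l2_nth (blinfun_apply (amp c N x - amp c M x) f) i = l2_nth (blinfun_apply (amp ?c' L x) f) i"
    using assms
    by (cases "i < M"; cases "i < N")
      (simp_all add: blinfun.diff_left *[OF assms(1)] *[OF assms(2)]
        complex_vector.scale_left_diff_distrib sum_subtractf sum_negf
        complex_vector.scale_zero_left complex_vector.scale_minus_left)
qed

text \<open>Transfers the Cauchy property from the corners of a scalar matrix to their
  amplifications by \<open>x\<close>.\<close>

lemma norm_amp_diff_le:
  "norm (amp c N x - amp c M x)
    \<le> norm (amp c N (id_blinfun :: complex \<Rightarrow>\<^sub>L complex) - amp c M id_blinfun) * norm x"
  by (simp add: amp_diff[of M "max M N" N] norm_amp_le)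

section \<open>Compact operators as norm limits of their finite corners\<close>

lemma truncate_compact_tendsto:
  fixes k :: "'a :: chilbert_space \<Rightarrow>\<^sub>L 'b :: chilbert_space l2"
  assumes k: "k \<in> compact_operators"
  shows "(\<lambda>N. truncate N o\<^sub>L k) \<longlonglongrightarrow> k"
proof (rule LIMSEQ_I)
  fix r :: real assume "r > 0"
  define e where "e = r / 4"
  have e: "e > 0" using \<open>r > 0\<close> by (simp add: e_def)
  have "compact (closure (blinfun_apply k ` cball 0 1))"
    using k by (simp add: compact_operators_def)
  \<comment> \<open>A finite \<open>e\<close>-net of the image of the unit ball. Truncations
    converge pointwise on the net, and as they are contractions, the convergence is uniform on the
    whole image.\<close>
  then obtain Y where Y: "finite Y" "closure (blinfun_apply k ` cball 0 1) \<subseteq> (\<Union>y\<in>Y. ball y e)"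
    using compact_eq_totally_bounded e by blast
  have "\<forall>\<^sub>F N in sequentially. \<forall>y\<in>Y. norm (blinfun_apply (truncate N) y - y) < e"
  proof (intro eventually_ball_finite[OF Y(1)] ballI)
    fix y
    show "\<forall>\<^sub>F N in sequentially. norm (blinfun_apply (truncate N) y - y) < e"
      using tendstoD[OF truncate_tendsto e] by (simp add: dist_norm)
  qed
  then obtain N0 where N0: "\<And>N y. N \<ge> N0 \<Longrightarrow> y \<in> Y \<Longrightarrow> norm (blinfun_apply (truncate N) y - y) < e"
    unfolding eventually_sequentially by blast
  have "norm ((truncate N o\<^sub>L k) - k) < r" if N: "N \<ge> N0" for N
  proof -
    have ball: "norm (blinfun_apply ((truncate N o\<^sub>L k) - k) u) \<le> 3 * e" if u: "norm u \<le> 1" for u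
    proof -
      have "blinfun_apply k u \<in> closure (blinfun_apply k ` cball 0 1)"
        using u closure_subset by fastforce
      then obtain y where y: "y \<in> Y" "norm (blinfun_apply k u - y) < e"
        using Y(2) by (force simp: dist_norm norm_minus_commute)
      have "blinfun_apply ((truncate N o\<^sub>L k) - k) u = blinfun_apply (truncate N) (blinfun_apply k u - y)
          + (blinfun_apply (truncate N) y - y) + (y - blinfun_apply k u)"
        by (simp add: blinfun.diff_left blinfun.diff_right)
      also have "norm \<dots> \<le> norm (blinfun_apply (truncate N) (blinfun_apply k u - y))
          + norm (blinfun_apply (truncate N) y - y) + norm (y - blinfun_apply k u)"
        by (intro norm_triangle_le add_mono norm_triangle_ineq order_refl)
      also have "\<dots> \<le> 3 * e"
        using norm_truncate_apply_le[of N "blinfun_apply k u - y"] y(2) N0[OF N y(1)]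
        by (simp add: norm_minus_commute[of y])
      finally show ?thesis .
    qed
    have "norm ((truncate N o\<^sub>L k) - k) \<le> 3 * e"
    proof (rule norm_blinfun_bound)
      fix u
      show "norm (blinfun_apply ((truncate N o\<^sub>L k) - k) u) \<le> 3 * e * norm u"
      proof (cases "u = 0")
        case False
        then show ?thesis
          using ball[of "inverse (norm u) *\<^sub>R u"] by (simp add: blinfun.scaleR_right field_simps)
      qed (simp add: blinfun.zero_right)
    qed (use e in simp)
    then show ?thesis using e by (simp add: e_def)
  qed
  then show "\<exists>no. \<forall>n\<ge>no. norm ((truncate n o\<^sub>L k) - k) < r"
    by blast
qed

text \<open>A single row of \<open>k\<close> is the functional \<open>cinner f v\<close> with
  \<open>v = k^* e_n\<close>, so the error of truncating on the right is at most the norm of the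
  tail of \<open>v\<close>.\<close>

lemma coord_truncate_tendsto:
  fixes k :: "'a :: chilbert_space l2 \<Rightarrow>\<^sub>L complex l2"
  assumes "k \<in> cblin"
  shows "(\<lambda>N. coord n o\<^sub>L k o\<^sub>L truncate N) \<longlonglongrightarrow> (coord n o\<^sub>L k)"
proof -
  define v where "v = blinfun_apply (cadjoint k) (single_l2 n 1)"
  have *: "norm ((coord n o\<^sub>L k o\<^sub>L truncate N) - (coord n o\<^sub>L k)) \<le> norm (blinfun_apply (truncate N) v - v)" for N
  proof (rule norm_blinfun_bound)
    fix f
    have nth: "l2_nth (blinfun_apply k g) n = cinner g v" for g
      unfolding v_def cinner_cadjoint_right[OF assms]
      by (subst cinner_commute) (simp add: cinner_single_l2 cinner_complex_def)
    have "cinner (blinfun_apply (truncate N) f) v = cinner f (blinfun_apply (truncate N) v)"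
      using cinner_cadjoint_right[OF truncate_cblin, of f N v] by simp
    then have "blinfun_apply ((coord n o\<^sub>L k o\<^sub>L truncate N) - (coord n o\<^sub>L k)) f
        = cinner f (blinfun_apply (truncate N) v - v)"
      by (simp add: blinfun.diff_left nth cinner_diff_right)
    then show "norm (blinfun_apply ((coord n o\<^sub>L k o\<^sub>L truncate N) - (coord n o\<^sub>L k)) f)
        \<le> norm (blinfun_apply (truncate N) v - v) * norm f"
      using norm_cinner_le[of f "blinfun_apply (truncate N) v - v"] by (simp add: mult.commute)
  qed simp
  have "(\<lambda>N. norm (blinfun_apply (truncate N) v - v)) \<longlonglongrightarrow> 0"
    using truncate_tendsto[of v] by (simp add: LIM_zero_iff tendsto_norm_zero_iff)
  then have "(\<lambda>N. norm ((coord n o\<^sub>L k o\<^sub>L truncate N) - (coord n o\<^sub>L k))) \<longlonglongrightarrow> 0"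
    by (rule Lim_null_comparison[rotated]) (use * in simp)
  then show ?thesis
    by (simp add: LIM_zero_iff tendsto_norm_zero_iff)
qed

text \<open>Compactness controls the truncation on the left. After it only finitely many rows
  remain, and truncation on the right converges on each row; compactness of the adjoint is thereby
  not invoked.\<close>

lemma compact_truncate_truncate_tendsto:
  fixes k :: "'a :: chilbert_space l2 \<Rightarrow>\<^sub>L complex l2"
  assumes k: "k \<in> compact_operators"
  shows "(\<lambda>N. truncate N o\<^sub>L k o\<^sub>L truncate N) \<longlonglongrightarrow> k"
proof (rule LIMSEQ_I)
  fix r :: real assume "r > 0"
  have kc: "k \<in> cblin"
    using k by (simp add: compact_operators_def)
  define e where "e = r / 4"
  have e: "e > 0" using \<open>r > 0\<close> by (simp add: e_def)
  obtain n where n: "\<And>N. N \<ge> n \<Longrightarrow> norm ((truncate N o\<^sub>L k) - k) < e"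
    using LIMSEQ_D[OF truncate_compact_tendsto[OF k] e] by blast
  have "truncate n o\<^sub>L k o\<^sub>L truncate N = (\<Sum>i<n. coord_in i o\<^sub>L (coord i o\<^sub>L k o\<^sub>L truncate N))"
    and "truncate n o\<^sub>L k = (\<Sum>i<n. coord_in i o\<^sub>L (coord i o\<^sub>L k))" for N
    by (auto intro!: blinfun_eqI simp: truncate_apply blinfun.sum_left)
  then have "(\<lambda>N. truncate n o\<^sub>L k o\<^sub>L truncate N) \<longlonglongrightarrow> (truncate n o\<^sub>L k)"
    by (simp only:) (intro tendsto_sum tendsto_intros coord_truncate_tendsto kc
        bounded_bilinear.tendsto[OF bounded_bilinear_blinfun_compose])
  from LIMSEQ_D[OF this e] obtain m where
    m: "\<And>N. N \<ge> m \<Longrightarrow> norm ((truncate n o\<^sub>L k o\<^sub>L truncate N) - (truncate n o\<^sub>L k)) < e"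
    by blast
  have "norm ((truncate N o\<^sub>L k o\<^sub>L truncate N) - k) < r" if N: "N \<ge> max n m" for N
  proof -
    let ?P = "truncate :: nat \<Rightarrow> 'a l2 \<Rightarrow>\<^sub>L 'a l2"
    let ?a = "(truncate N o\<^sub>L k) - k" and ?b = "(truncate n o\<^sub>L k) - k"
    have "norm (?P N) \<le> 1"
      by (rule norm_truncate_le)
    then have *: "norm (a o\<^sub>L ?P N) \<le> norm a" for a :: "'a l2 \<Rightarrow>\<^sub>L complex l2"
      using norm_blinfun_compose[of a "?P N"] mult_left_mono[of "norm (?P N)" 1 "norm a"]
      by simp
    \<comment> \<open>Four errors, each below \<open>e = r / 4\<close>: truncation on the left at
      \<open>N\<close> and, twice, at the fixed \<open>n\<close>, and truncation on the right of the
      first \<open>n\<close> rows.\<close>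
    have "(truncate N o\<^sub>L k o\<^sub>L ?P N) - k = (?a o\<^sub>L ?P N) - (?b o\<^sub>L ?P N)
        + ((truncate n o\<^sub>L k o\<^sub>L ?P N) - (truncate n o\<^sub>L k)) + ?b"
      by (simp add: blinfun_compose_diff_left)
    also have "norm \<dots> \<le> norm (?a o\<^sub>L ?P N) + norm (?b o\<^sub>L ?P N)
        + norm ((truncate n o\<^sub>L k o\<^sub>L ?P N) - (truncate n o\<^sub>L k)) + norm ?b"
      by (intro norm_triangle_le add_mono norm_triangle_ineq4 order_refl)
    also have "\<dots> < r"
      using *[of ?a] *[of ?b] n[of N] n[of n] m[of N] N by (simp add: e_def)
    finally show ?thesis .
  qed
  then show "\<exists>no. \<forall>N\<ge>no. norm ((truncate N o\<^sub>L k o\<^sub>L truncate N) - k) < r"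
    by blast
qed

section \<open>From compact operators to matrix units\<close>

lemma bounded_linear_tensor_l2: "bounded_linear (\<lambda>f. h \<otimes>\<^sub>v f)"
proof (rule bounded_linear_intro[where K = "norm h"])
  show "h \<otimes>\<^sub>v (r *\<^sub>R f) = r *\<^sub>R (h \<otimes>\<^sub>v f)" for r f
    using tensor_l2_scaleC_right[of h "complex_of_real r" f] by (simp add: scaleC_of_real)
  show "norm (h \<otimes>\<^sub>v f) \<le> norm f * norm h" for f
    by (simp add: norm_l2_def norm_scaleC power_mult_distrib suminf_mult2[symmetric]
        real_sqrt_mult summable_l2)
qed (rule tensor_l2_add_right)

lemma op_tensor_matrix_unit:
  assumes "x \<in> cblin"
  shows "op_tensor x (coord_in i o\<^sub>L coord j) = coord_in i o\<^sub>L x o\<^sub>L coord j"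
  by (rule op_tensor_eqI)
    (auto simp: assms cblinD[OF assms] complex_vector.scale_zero_left intro!: l2_eqI)

lemma matrix_unit_compact: "coord_in i o\<^sub>L coord j \<in> (compact_operators :: (complex l2 \<Rightarrow>\<^sub>L complex l2) set)"
proof -
  let ?K = "blinfun_apply (coord_in i) ` cball (0 :: complex) 1"
  have K: "compact ?K"
    by (intro compact_continuous_image blinfun.continuous_on continuous_on_const continuous_on_id) simp
  let ?I = "blinfun_apply (coord_in i o\<^sub>L coord j) ` cball (0 :: complex l2) 1"
  have "closure ?I \<subseteq> ?K"
  proof (rule closure_minimal)
    show "?I \<subseteq> ?K"
      by (auto intro!: imageI order_trans[OF norm_nth_le_norm_l2])
  qed (rule compact_imp_closed[OF K])
  then have "?K \<inter> closure ?I = closure ?I"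
    by (rule Int_absorb1)
  then have "compact (closure ?I)"
    using compact_Int_closed[OF K closed_closure, of ?I] by argo
  then show ?thesis
    unfolding compact_operators_def by (intro CollectI conjI cblin_compose coord_cblin)
qed

lemma amp_in_cspan:
  assumes "\<And>i j. coord_in i o\<^sub>L x o\<^sub>L coord j \<in> S" "csubspace S"
  shows "amp c N x \<in> S"
  unfolding amp_def
  by (intro complex_vector.subspace_sum complex_vector.subspace_scale assms)

text \<open>The corners of the matrix \<open>c\<close> of \<open>k\<close> converge to
  \<open>k\<close>, hence the operators \<open>amp c N x\<close> are Cauchy. Their limit acts
  correctly on elementary tensors, so it is \<open>op_tensor x k\<close>; this also establishes the
  existence behind the definite description of \<open>op_tensor\<close>.\<close>

lemma op_tensor_compact:
  assumes x: "x \<in> cblin" and k: "k \<in> compact_operators"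
    and S: "\<And>i j. coord_in i o\<^sub>L x o\<^sub>L coord j \<in> S" "csubspace S" "closed S"
  shows "op_tensor x k \<in> S"
proof -
  have kc: "k \<in> cblin"
    using k by (simp add: compact_operators_def)
  define c where "c i j = l2_nth (blinfun_apply k (single_l2 j 1)) i" for i j
  let ?id = "id_blinfun :: complex \<Rightarrow>\<^sub>L complex"
  have kj: "blinfun_apply k (single_l2 j a) = a *\<^sub>C blinfun_apply k (single_l2 j 1)" for j a
  proof -
    have "single_l2 j a = a *\<^sub>C single_l2 j 1"
      by (rule l2_eqI) (simp add: scaleC_complex_def)
    then show ?thesis by (simp add: cblinD[OF kc])
  qed
  have "amp c N ?id = truncate N o\<^sub>L k o\<^sub>L truncate N" for N
  proof (rule blinfun_eqI, rule l2_eqI)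
    fix f i
    have "l2_nth (blinfun_apply k (blinfun_apply (truncate N) f)) i = (\<Sum>j<N. c i j *\<^sub>C l2_nth f j)"
      unfolding truncate_apply blinfun.sum_right
      by (subst kj) (simp add: c_def scaleC_complex_def mult.commute)
    then show "l2_nth (blinfun_apply (amp c N ?id) f) i
        = l2_nth (blinfun_apply (truncate N o\<^sub>L k o\<^sub>L truncate N) f) i"
      by simp
  qed
  then have lim_id: "(\<lambda>N. amp c N ?id) \<longlonglongrightarrow> k"
    using compact_truncate_truncate_tendsto[OF k] by simp
  have "Cauchy (\<lambda>N. amp c N x)"
  proof (rule CauchyI)
    fix e :: real assume "e > 0"
    \<comment> \<open>The summand 1 keeps the denominator positive when \<open>x\<close> is
      zero.\<close>
    then have e: "e / (norm x + 1) > 0"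
      by (simp add: add_nonneg_pos)
    obtain M where M: "\<And>m n. m \<ge> M \<Longrightarrow> n \<ge> M \<Longrightarrow> norm (amp c m ?id - amp c n ?id) < e / (norm x + 1)"
      using CauchyD[OF LIMSEQ_imp_Cauchy[OF lim_id] e] by blast
    show "\<exists>M. \<forall>m\<ge>M. \<forall>n\<ge>M. norm (amp c m x - amp c n x) < e"
    proof (intro exI allI impI)
      fix m n assume mn: "m \<ge> M" "n \<ge> M"
      have "norm (amp c m x - amp c n x) \<le> norm (amp c m ?id - amp c n ?id) * norm x"
        by (rule norm_amp_diff_le)
      also have "\<dots> \<le> norm (amp c m ?id - amp c n ?id) * (norm x + 1)"
        by (intro mult_left_mono) auto
      also have "\<dots> < e"
        using M[OF mn] by (simp add: pos_less_divide_eq add_nonneg_pos)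
      finally show "norm (amp c m x - amp c n x) < e" .
    qed
  qed
  then obtain T where T: "(\<lambda>N. amp c N x) \<longlonglongrightarrow> T"
    using Cauchy_convergent_iff convergent_def by blast
  have TS: "T \<in> S"
    by (rule closed_sequentially[OF S(3) _ T]) (rule amp_in_cspan[OF S(1,2)])
  have Tc: "T \<in> cblin"
    by (rule closed_sequentially[OF closed_cblin _ T])
      (rule amp_in_cspan, simp_all add: x csubspace_cblin)
  have "blinfun_apply T (h \<otimes>\<^sub>v f) = blinfun_apply x h \<otimes>\<^sub>v blinfun_apply k f" for h f
  proof (rule LIMSEQ_unique)
    show "(\<lambda>N. blinfun_apply (amp c N x) (h \<otimes>\<^sub>v f)) \<longlonglongrightarrow> blinfun_apply T (h \<otimes>\<^sub>v f)"
      by (intro blinfun.tendsto T tendsto_const)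
    have "blinfun_apply (amp c N x) (h \<otimes>\<^sub>v f) = blinfun_apply x h \<otimes>\<^sub>v blinfun_apply (amp c N ?id) f" for N
      by (rule l2_eqI)
        (simp add: cblinD[OF x] scaleC_scaleC scaleC_complex_def complex_vector.scale_sum_left
          complex_vector.scale_zero_left)
    then show "(\<lambda>N. blinfun_apply (amp c N x) (h \<otimes>\<^sub>v f)) \<longlonglongrightarrow> blinfun_apply x h \<otimes>\<^sub>v blinfun_apply k f"
      by (simp only:) (intro bounded_linear.tendsto[OF bounded_linear_tensor_l2] blinfun.tendsto
          lim_id tendsto_const)
  qed
  then have "op_tensor x k = T"
    by (intro op_tensor_eqI Tc)
  then show ?thesis using TS by simp
qed

text \<open>Allows all later membership claims to be checked on block matrices with a single nonzero
  block.\<close>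

lemma tensor_compact_eq:
  assumes "X \<subseteq> cblin"
  shows "tensor_compact X = closure (cspan {coord_in i o\<^sub>L x o\<^sub>L coord j | i j x. x \<in> X})"
proof
  show "tensor_compact X \<subseteq> closure (cspan {coord_in i o\<^sub>L x o\<^sub>L coord j | i j x. x \<in> X})"
    unfolding tensor_compact_def
  proof (intro closure_cspan_minimal csubspace_closure_cspan closed_closure subsetI, clarify)
    fix x :: "'a \<Rightarrow>\<^sub>L 'b" and k :: "complex l2 \<Rightarrow>\<^sub>L complex l2"
    assume "x \<in> X" "k \<in> compact_operators"
    then show "op_tensor x k \<in> closure (cspan {coord_in i o\<^sub>L x o\<^sub>L coord j | i j x. x \<in> X})"
      using assms
      by (intro op_tensor_compact csubspace_closure_cspan closed_closure closure_cspan_base) auto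
  qed
  show "closure (cspan {coord_in i o\<^sub>L x o\<^sub>L coord j | i j x. x \<in> X}) \<subseteq> tensor_compact X"
    unfolding tensor_compact_def
  proof (intro closure_cspan_minimal csubspace_closure_cspan closed_closure subsetI, clarify)
    fix i j and x :: "'a \<Rightarrow>\<^sub>L 'b" assume "x \<in> X"
    then show "coord_in i o\<^sub>L x o\<^sub>L coord j
        \<in> closure (cspan {op_tensor x k | x k. x \<in> X \<and> k \<in> compact_operators})"
      using assms matrix_unit_compact[of i j] op_tensor_matrix_unit[of x i j, symmetric]
      by (intro closure_cspan_base) blast
  qed
qed

lemma tensor_compact_generator:
  "X \<subseteq> cblin \<Longrightarrow> x \<in> X \<Longrightarrow> coord_in i o\<^sub>L x o\<^sub>L coord j \<in> tensor_compact X"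
  unfolding tensor_compact_eq by (intro closure_cspan_base) blast

lemma csubspace_tensor_compact: "csubspace (tensor_compact X)"
  and closed_tensor_compact: "closed (tensor_compact X)"
  unfolding tensor_compact_def by (rule csubspace_closure_cspan closed_closure)+

lemma tensor_compact_subset_cblin: "X \<subseteq> cblin \<Longrightarrow> tensor_compact X \<subseteq> cblin"
  unfolding tensor_compact_eq by (rule closure_cspan_subset_cblin) auto

text \<open>Lets multiplication on the right be handled as multiplication on the left of the adjoint
  space.\<close>

lemma tensor_compact_cadjoint:
  assumes "X \<subseteq> cblin"
  shows "tensor_compact (cadjoint ` X) = cadjoint ` tensor_compact X"
proof -
  have "cadjoint (coord_in i o\<^sub>L x o\<^sub>L coord j) = coord_in j o\<^sub>L cadjoint x o\<^sub>L coord i" if "x \<in> X" for i j x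
    using that assms by (subst cadjoint_compose cadjoint_coord cadjoint_coord_in; auto simp: blinfun_compose_assoc)+
  then have "cadjoint ` {coord_in i o\<^sub>L x o\<^sub>L coord j | i j x. x \<in> X}
      = {coord_in i o\<^sub>L x o\<^sub>L coord j | i j x. x \<in> cadjoint ` X}"
    by (auto simp: image_iff) metis+
  moreover have "{coord_in i o\<^sub>L x o\<^sub>L coord j | i j x. x \<in> X} \<subseteq> cblin" "cadjoint ` X \<subseteq> cblin"
    using assms by auto
  ultimately show ?thesis
    using assms by (simp add: tensor_compact_eq cadjoint_closure_cspan)
qed

section \<open>Isometries between amplifications\<close>

text \<open>A block matrix with at most one nonzero block per row: row \<open>n\<close> has
  \<open>b n\<close> in column \<open>r n\<close>. The series says that the blocks of each column
  satisfy \<open>\<Sum> b_n^* b_n = 1\<close> strongly; as distinct columns occupy distinct rows,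
  the matrix is then an isometry. The parity embeddings and the columns built from a TRO both have
  this shape.\<close>

definition isometric_column ::
    "(nat \<Rightarrow> nat) \<Rightarrow> (nat \<Rightarrow> 'a :: chilbert_space \<Rightarrow>\<^sub>L 'b :: chilbert_space) \<Rightarrow> bool"
  where "isometric_column r b \<longleftrightarrow> (\<forall>n. b n \<in> cblin) \<and>
    (\<forall>j h. (\<lambda>n. if r n = j then blinfun_apply (cadjoint (b n)) (blinfun_apply (b n) h) else 0) sums h)"

definition column ::
    "(nat \<Rightarrow> nat) \<Rightarrow> (nat \<Rightarrow> 'a :: chilbert_space \<Rightarrow>\<^sub>L 'b :: chilbert_space) \<Rightarrow> 'a l2 \<Rightarrow>\<^sub>L 'b l2"
  where "column r b = Blinfun (\<lambda>f. Abs_l2 (\<lambda>n. blinfun_apply (b n) (l2_nth f (r n))))"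

text \<open>Rows are grouped by the coordinate \<open>j\<close> that they read; pairing the defining
  series with \<open>h\<close> shows that the squared norms in one group add up to at most
  \<open>(norm h)^2\<close>. The bound makes \<open>column\<close> well defined and
  contractive.\<close>

lemma isometric_column_sum_le:
  assumes "isometric_column r b"
  shows "(\<Sum>n<N. (norm (blinfun_apply (b n) (l2_nth f (r n))))\<^sup>2) \<le> (norm f)\<^sup>2"
proof -
  have le: "(\<Sum>n | n < N \<and> r n = j. (norm (blinfun_apply (b n) h))\<^sup>2) \<le> (norm h)\<^sup>2" for j h
  proof -
    have "(\<lambda>n. if r n = j then blinfun_apply (cadjoint (b n)) (blinfun_apply (b n) h) else 0) sums h"
      using assms by (simp add: isometric_column_def)
    then have "(\<lambda>n. cinner (if r n = j then blinfun_apply (cadjoint (b n)) (blinfun_apply (b n) h)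
        else 0) h) sums cinner h h"
      by (rule bounded_linear.sums[OF bounded_bilinear.bounded_linear_left[OF bounded_bilinear_cinner]])
    then have "(\<lambda>n. Re (cinner (if r n = j then blinfun_apply (cadjoint (b n)) (blinfun_apply (b n) h)
        else 0) h)) sums Re (cinner h h)"
      by (rule sums_Re)
    moreover have "Re (cinner (if r n = j then blinfun_apply (cadjoint (b n)) (blinfun_apply (b n) h)
        else 0) h) = (if r n = j then (norm (blinfun_apply (b n) h))\<^sup>2 else 0)" for n
      using assms by (simp add: isometric_column_def cinner_cadjoint_left norm_sq_eq)
    ultimately have s: "(\<lambda>n. if r n = j then (norm (blinfun_apply (b n) h))\<^sup>2 else 0) sums (norm h)\<^sup>2"
      by (simp add: norm_sq_eq)
    have "(\<Sum>n | n < N \<and> r n = j. (norm (blinfun_apply (b n) h))\<^sup>2)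
        = (\<Sum>n<N. if r n = j then (norm (blinfun_apply (b n) h))\<^sup>2 else 0)"
      by (simp add: sum.inter_filter[symmetric])
    also have "\<dots> \<le> (norm h)\<^sup>2"
      using sum_le_suminf[OF sums_summable[OF s], of "{..<N}"] sums_unique[OF s] by simp
    finally show ?thesis .
  qed
  have "(\<Sum>n<N. (norm (blinfun_apply (b n) (l2_nth f (r n))))\<^sup>2)
      = (\<Sum>j\<in>r ` {..<N}. \<Sum>n | n \<in> {..<N} \<and> r n = j. (norm (blinfun_apply (b n) (l2_nth f (r n))))\<^sup>2)"
    by (rule sum.image_gen) simp
  also have "\<dots> = (\<Sum>j\<in>r ` {..<N}. \<Sum>n | n < N \<and> r n = j. (norm (blinfun_apply (b n) (l2_nth f j)))\<^sup>2)"
    by (intro sum.cong) auto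
  also have "\<dots> \<le> (\<Sum>j\<in>r ` {..<N}. (norm (l2_nth f j))\<^sup>2)"
    by (intro sum_mono le)
  also have "\<dots> \<le> (norm f)\<^sup>2"
    by (rule sum_norm_nth_le) simp
  finally show ?thesis .
qed

lemma l2_nth_column [simp]:
  assumes b: "isometric_column r b"
  shows "l2_nth (blinfun_apply (column r b) f) n = blinfun_apply (b n) (l2_nth f (r n))"
proof -
  define F where "F f = Abs_l2 (\<lambda>n. blinfun_apply (b n) (l2_nth f (r n)))" for f
  have "summable (\<lambda>n. (norm (blinfun_apply (b n) (l2_nth f (r n))))\<^sup>2)" for f
    by (rule summableI_nonneg_bounded[OF _ isometric_column_sum_le[OF b]]) simp
  then have F_nth: "l2_nth (F f) n = blinfun_apply (b n) (l2_nth f (r n))" for f n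
    by (simp add: F_def Abs_l2_inverse)
  have "bounded_linear F"
  proof (rule bounded_linear_intro[where K = 1])
    show "norm (F f) \<le> norm f * 1" for f
    proof -
      have "norm (F f) \<le> norm f"
      proof (rule norm_l2_le)
        fix N
        show "L2_set (\<lambda>n. norm (l2_nth (F f) n)) {..<N} \<le> norm f"
          unfolding L2_set_def F_nth using isometric_column_sum_le[OF b, where N = N and f = f]
          by (intro real_le_lsqrt) auto
      qed
      then show ?thesis by simp
    qed
  qed (auto intro!: l2_eqI simp: F_nth blinfun.bilinear_simps)
  then show ?thesis
    by (simp add: column_def bounded_linear_Blinfun_apply F_nth flip: F_def)
qed

lemma column_cblin [simp]: "isometric_column r b \<Longrightarrow> column r b \<in> cblin"
  by (auto simp: cblin_def isometric_column_def intro!: l2_eqI)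

lemma cadjoint_column_single:
  assumes b: "isometric_column r b"
  shows "blinfun_apply (cadjoint (column r b)) (single_l2 n g)
    = single_l2 (r n) (blinfun_apply (cadjoint (b n)) g)"
  by (rule cinner_eqI) (use b in \<open>simp add: cinner_cadjoint_right cinner_single_l2_right
      isometric_column_def\<close>)

lemma column_isometry:
  assumes b: "isometric_column r b"
  shows "cadjoint (column r b) o\<^sub>L column r b = id_blinfun"
proof (rule blinfun_l2_eqI)
  fix j and h :: 'a
  let ?W = "column r b"
  let ?g = "blinfun_apply ?W (single_l2 j h)"
  have "(\<lambda>n. blinfun_apply (cadjoint ?W) (single_l2 n (l2_nth ?g n))) sums blinfun_apply (cadjoint ?W) ?g"
    by (intro bounded_linear.sums[OF blinfun.bounded_linear_right] sums_single_l2)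
  moreover have "blinfun_apply (cadjoint ?W) (single_l2 n (l2_nth ?g n)) = single_l2 j
      (if r n = j then blinfun_apply (cadjoint (b n)) (blinfun_apply (b n) h) else 0)" for n
    using b by (auto simp: cadjoint_column_single intro!: l2_eqI)
  moreover have "(\<lambda>n. blinfun_apply (coord_in j)
      (if r n = j then blinfun_apply (cadjoint (b n)) (blinfun_apply (b n) h) else 0))
      sums blinfun_apply (coord_in j) h"
    using b by (intro bounded_linear.sums[OF blinfun.bounded_linear_right])
      (simp add: isometric_column_def)
  ultimately show "blinfun_apply (cadjoint ?W o\<^sub>L ?W) (single_l2 j h)
      = blinfun_apply id_blinfun (single_l2 j h)"
    by (simp add: sums_unique2)
qed

lemma isometry_norm:
  assumes "V \<in> cblin" "cadjoint V o\<^sub>L V = id_blinfun"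
  shows "norm (blinfun_apply V f) = norm f"
proof -
  have "(norm (blinfun_apply V f))\<^sup>2 = Re (cinner f (blinfun_apply (cadjoint V o\<^sub>L V) f))"
    by (simp add: norm_sq_eq cinner_cadjoint_right assms(1))
  then show ?thesis
    by (simp add: assms(2) norm_sq_eq[symmetric])
qed

text \<open>Left multiplication by \<open>W\<close> carries \<open>X \<otimes> \<K>\<close> into
  \<open>Z \<otimes> \<K>\<close>. The relation is stable under composition, sums and differences,
  hence passes to the polynomials from which the unitary is built.\<close>

definition tc_maps ::
    "('b l2 \<Rightarrow>\<^sub>L 'c l2) \<Rightarrow> ('a :: chilbert_space \<Rightarrow>\<^sub>L 'b :: chilbert_space) set
      \<Rightarrow> ('a \<Rightarrow>\<^sub>L 'c :: chilbert_space) set \<Rightarrow> bool"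
  where "tc_maps W X Z \<longleftrightarrow> (\<forall>T \<in> tensor_compact X. W o\<^sub>L T \<in> tensor_compact Z)"

lemma tc_maps_compose: "tc_maps V X Y \<Longrightarrow> tc_maps W Y Z \<Longrightarrow> tc_maps (W o\<^sub>L V) X Z"
  by (simp add: tc_maps_def blinfun_compose_assoc)

lemma tc_maps_id: "tc_maps id_blinfun X X"
  by (simp add: tc_maps_def)

lemma tc_maps_add: "tc_maps V X Z \<Longrightarrow> tc_maps W X Z \<Longrightarrow> tc_maps (V + W) X Z"
  by (simp add: tc_maps_def blinfun_compose_add_left
      complex_vector.subspace_add[OF csubspace_tensor_compact])

lemma tc_maps_diff: "tc_maps V X Z \<Longrightarrow> tc_maps W X Z \<Longrightarrow> tc_maps (V - W) X Z"
  by (simp add: tc_maps_def blinfun_compose_diff_left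
      complex_vector.subspace_diff[OF csubspace_tensor_compact])

lemma tc_mapsI:
  assumes "W \<in> cblin" "X \<subseteq> cblin"
    and "\<And>i j x. x \<in> X \<Longrightarrow> W o\<^sub>L (coord_in i o\<^sub>L x o\<^sub>L coord j) \<in> tensor_compact Z"
  shows "tc_maps W X Z"
  unfolding tc_maps_def
proof
  fix T assume "T \<in> tensor_compact X"
  then show "W o\<^sub>L T \<in> tensor_compact Z"
    unfolding tensor_compact_eq[OF assms(2)]
    by (rule closure_cspan_compose_left[OF assms(1) csubspace_tensor_compact closed_tensor_compact,
          rotated]) (use assms(3) in blast)
qed

text \<open>Each row has one block, so the adjoint carries a generator to a single generator and no
  convergence is involved.\<close>

lemma tc_maps_cadjoint_column:
  assumes b: "isometric_column r b" and "X \<subseteq> cblin" "Z \<subseteq> cblin"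
    and bZ: "\<And>n z. z \<in> Z \<Longrightarrow> cadjoint (b n) o\<^sub>L z \<in> X"
  shows "tc_maps (cadjoint (column r b)) Z X"
proof (rule tc_mapsI)
  fix i j z assume z: "z \<in> Z"
  have "cadjoint (column r b) o\<^sub>L (coord_in i o\<^sub>L z o\<^sub>L coord j)
      = coord_in (r i) o\<^sub>L (cadjoint (b i) o\<^sub>L z) o\<^sub>L coord j"
    by (rule blinfun_eqI) (simp add: cadjoint_column_single[OF b])
  then show "cadjoint (column r b) o\<^sub>L (coord_in i o\<^sub>L z o\<^sub>L coord j) \<in> tensor_compact X"
    using tensor_compact_generator[OF assms(2) bZ[OF z]] by simp
qed (use assms in auto)

text \<open>A generator is carried to an infinite column with blocks \<open>b n x\<close>. The
  squared norm of its tail at a vector \<open>g\<close> is the real part of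
  \<open>cinner ((x - s N) g) (x g)\<close>, so norm convergence of \<open>s N\<close> to
  \<open>x\<close> forces norm convergence of the truncated columns, which are finite sums of
  generators.\<close>

lemma tc_maps_column:
  assumes b: "isometric_column r b" and X: "X \<subseteq> cblin" and Z: "Z \<subseteq> cblin"
    and bX: "\<And>n x. x \<in> X \<Longrightarrow> b n o\<^sub>L x \<in> Z"
    and sums: "\<And>i x. x \<in> X \<Longrightarrow>
      (\<lambda>n. if r n = i then cadjoint (b n) o\<^sub>L b n o\<^sub>L x else 0) sums x"
  shows "tc_maps (column r b) X Z"
proof (rule tc_mapsI)
  fix i j x assume x: "x \<in> X"
  let ?W = "column r b"
  let ?V = "?W o\<^sub>L coord_in i o\<^sub>L x"
  define s where "s N = (\<Sum>n<N. if r n = i then cadjoint (b n) o\<^sub>L b n o\<^sub>L x else 0)" for N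
  have s: "s \<longlonglongrightarrow> x"
    using sums[OF x, of i] unfolding s_def sums_def .
  have bc: "b n \<in> cblin" for n
    using b by (simp add: isometric_column_def)
  have bound: "norm ((truncate N o\<^sub>L ?V) - ?V) \<le> sqrt (norm (x - s N) * norm x)" for N
  proof (rule norm_blinfun_bound)
    fix g
    let ?f = "blinfun_apply ?V g"
    \<comment> \<open>Truncation is a self-adjoint idempotent.\<close>
    have eq: "cinner ?f (blinfun_apply (truncate N) ?f)
        = complex_of_real ((norm (blinfun_apply (truncate N) ?f))\<^sup>2)"
    proof -
      have "blinfun_apply (truncate N) (blinfun_apply (truncate N) ?f) = blinfun_apply (truncate N) ?f"
        by (rule l2_eqI) simp
      then have "cinner (blinfun_apply (truncate N) ?f) (blinfun_apply (truncate N) ?f)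
          = cinner ?f (blinfun_apply (truncate N) ?f)"
        using cinner_cadjoint_right[OF truncate_cblin, of ?f N "blinfun_apply (truncate N) ?f"]
        by (simp only: cadjoint_truncate)
      then show ?thesis by (simp add: cinner_self)
    qed
    have "(norm (?f - blinfun_apply (truncate N) ?f))\<^sup>2
        = (norm ?f)\<^sup>2 - (norm (blinfun_apply (truncate N) ?f))\<^sup>2"
      unfolding norm_diff_sq eq by simp
    also have "(norm ?f)\<^sup>2 = Re (cinner (blinfun_apply x g) (blinfun_apply x g))"
      by (simp add: isometry_norm column_isometry b norm_sq_eq[symmetric])
    also have "(norm (blinfun_apply (truncate N) ?f))\<^sup>2
        = (\<Sum>n<N. (norm (l2_nth ?f n))\<^sup>2)"
      by (subst norm_l2_sq_finite[where N = N]) simp_all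
    also have "\<dots> = Re (cinner (blinfun_apply (s N) g) (blinfun_apply x g))"
      unfolding s_def blinfun.sum_left cinner_sum_left Re_sum
      by (intro sum.cong refl) (simp add: b norm_sq_eq cinner_cadjoint_left bc)
    finally have "(norm (?f - blinfun_apply (truncate N) ?f))\<^sup>2
        = Re (cinner (blinfun_apply (x - s N) g) (blinfun_apply x g))"
      by (simp add: blinfun.diff_left cinner_diff_left)
    also have "\<dots> \<le> norm (blinfun_apply (x - s N) g) * norm (blinfun_apply x g)"
      by (rule order_trans[OF complex_Re_le_cmod norm_cinner_le])
    also have "\<dots> \<le> (norm (x - s N) * norm g) * (norm x * norm g)"
      by (intro mult_mono norm_blinfun) auto
    also have "\<dots> = (sqrt (norm (x - s N) * norm x) * norm g)\<^sup>2"
      by (simp add: power_mult_distrib power2_eq_square mult_ac)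
    finally have "norm (?f - blinfun_apply (truncate N) ?f) \<le> sqrt (norm (x - s N) * norm x) * norm g"
      by (rule power2_le_imp_le) simp
    then show "norm (blinfun_apply ((truncate N o\<^sub>L ?V) - ?V) g) \<le> sqrt (norm (x - s N) * norm x) * norm g"
      by (simp add: blinfun.diff_left norm_minus_commute)
  qed simp
  have "(\<lambda>N. sqrt (norm (x - s N) * norm x)) \<longlonglongrightarrow> sqrt (norm (x - x) * norm x)"
    by (intro tendsto_intros s)
  then have "(\<lambda>N. norm ((truncate N o\<^sub>L ?V) - ?V)) \<longlonglongrightarrow> 0"
    by (intro Lim_null_comparison[OF always_eventually, of "\<lambda>N. norm ((truncate N o\<^sub>L ?V) - ?V)"])
      (use bound in auto)
  then have "(\<lambda>N. truncate N o\<^sub>L ?V) \<longlonglongrightarrow> ?V"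
    by (simp add: LIM_zero_iff tendsto_norm_zero_iff)
  then have lim: "(\<lambda>N. (truncate N o\<^sub>L ?V) o\<^sub>L coord j) \<longlonglongrightarrow> (?V o\<^sub>L coord j)"
    by (intro bounded_bilinear.tendsto[OF bounded_bilinear_blinfun_compose] tendsto_const)
  have "(truncate N o\<^sub>L ?V) o\<^sub>L coord j \<in> tensor_compact Z" for N
  proof -
    have "(truncate N o\<^sub>L ?V) o\<^sub>L coord j
        = (\<Sum>n<N. if r n = i then coord_in n o\<^sub>L (b n o\<^sub>L x) o\<^sub>L coord j else 0)"
    proof (rule blinfun_eqI, rule l2_eqI)
      fix f m
      let ?y = "if r m = i then blinfun_apply (b m) (blinfun_apply x (l2_nth f j)) else 0"
      have "l2_nth (blinfun_apply (\<Sum>n<N. if r n = i then coord_in n o\<^sub>L (b n o\<^sub>L x) o\<^sub>L coord j else 0) f) m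
          = (\<Sum>n<N. if n = m then ?y else 0)"
        unfolding blinfun.sum_left l2_nth_sum by (intro sum.cong) auto
      then show "l2_nth (blinfun_apply ((truncate N o\<^sub>L ?V) o\<^sub>L coord j) f) m
          = l2_nth (blinfun_apply (\<Sum>n<N. if r n = i then coord_in n o\<^sub>L (b n o\<^sub>L x) o\<^sub>L coord j else 0) f) m"
        by (simp add: b)
    qed
    also have "\<dots> \<in> tensor_compact Z"
      by (intro complex_vector.subspace_sum csubspace_tensor_compact)
        (auto intro: tensor_compact_generator[OF Z] bX x
          complex_vector.subspace_0[OF csubspace_tensor_compact])
    finally show ?thesis .
  qed
  then have "?V o\<^sub>L coord j \<in> tensor_compact Z"
    by (rule closed_sequentially[OF closed_tensor_compact _ lim])
  then show "?W o\<^sub>L (coord_in i o\<^sub>L x o\<^sub>L coord j) \<in> tensor_compact Z"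
    by (simp add: blinfun_compose_assoc)
qed (use b X in auto)

section \<open>The splitting of \<open>\<ell>^2\<close> into even and odd coordinates\<close>

definition parity_column :: "bool \<Rightarrow> 'a :: chilbert_space l2 \<Rightarrow>\<^sub>L 'a l2"
  where "parity_column p = column (\<lambda>n. n div 2) (\<lambda>n. if even n = p then id_blinfun else 0)"

text \<open>For each \<open>j\<close> just one index contributes: \<open>2 * j\<close> if
  \<open>p\<close> holds, and \<open>2 * j + 1\<close> otherwise.\<close>

lemma parity_sums:
  "(\<lambda>n. if n div 2 = j then (if even n = p then x else 0) else 0) sums (x :: 'a :: real_normed_vector)"
proof -
  have "n div 2 = j \<and> even n = p \<longleftrightarrow> n = 2 * j + of_bool (\<not> p)" for n
    by (cases p; simp; presburger)
  moreover have "(if n div 2 = j then (if even n = p then x else 0) else 0)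
      = (if n div 2 = j \<and> even n = p then x else 0)" for n
    by simp
  ultimately have "(\<lambda>n. if n div 2 = j then (if even n = p then x else 0) else 0)
      = (\<lambda>n. if n = 2 * j + of_bool (\<not> p) then x else 0)"
    by (simp only:)
  then show ?thesis
    using sums_single[of "2 * j + of_bool (\<not> p)" "\<lambda>_. x"] by simp
qed

lemma isometric_parity_column:
  "isometric_column (\<lambda>n. n div 2) (\<lambda>n. if even n = p then id_blinfun else 0)"
proof -
  have "(if n div 2 = j then blinfun_apply (cadjoint (if even n = p then id_blinfun else 0))
      (blinfun_apply (if even n = p then id_blinfun else 0) h) else 0)
      = (if n div 2 = j then (if even n = p then h else 0) else 0)" for n j :: nat and h :: 'a
    by simp
  then show ?thesis
    by (simp add: isometric_column_def parity_sums)
qed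

lemma parity_column_cblin [simp]: "parity_column p \<in> cblin"
  and parity_column_isometry: "cadjoint (parity_column p) o\<^sub>L parity_column p = id_blinfun"
  by (simp_all add: parity_column_def column_isometry isometric_parity_column)

lemma l2_nth_parity_column:
  "l2_nth (blinfun_apply (parity_column p) f) n = (if even n = p then l2_nth f (n div 2) else 0)"
  by (simp add: parity_column_def isometric_parity_column)

lemma cadjoint_parity_column_single:
  "blinfun_apply (cadjoint (parity_column p)) (single_l2 n h)
    = single_l2 (n div 2) (if even n = p then h else 0)"
  by (simp add: parity_column_def cadjoint_column_single[OF isometric_parity_column])

text \<open>Every coordinate is either even or odd, so the two range projections add up to the
  identity.\<close>

lemma parity_column_complement:
  "(parity_column True o\<^sub>L cadjoint (parity_column True))
    + (parity_column False o\<^sub>L cadjoint (parity_column False)) = id_blinfun"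
proof (rule blinfun_l2_eqI, rule l2_eqI)
  fix n m :: nat and h :: 'a
  have "m = n \<longleftrightarrow> m div 2 = n div 2 \<and> even m = even n"
    by presburger
  then show "l2_nth (blinfun_apply ((parity_column True o\<^sub>L cadjoint (parity_column True))
      + (parity_column False o\<^sub>L cadjoint (parity_column False))) (single_l2 n h)) m
      = l2_nth (blinfun_apply id_blinfun (single_l2 n h)) m"
    by (auto simp: blinfun.add_left l2_nth_parity_column cadjoint_parity_column_single)
qed

lemma tc_maps_parity_column:
  assumes X: "X \<subseteq> cblin" "csubspace X"
  shows "tc_maps (parity_column p) X X" "tc_maps (cadjoint (parity_column p)) X X"
proof -
  have 0: "0 \<in> X"
    using X(2) by (rule complex_vector.subspace_0)
  have sums: "(\<lambda>n. if n div 2 = j then cadjoint (if even n = p then id_blinfun else 0)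
      o\<^sub>L (if even n = p then id_blinfun else 0) o\<^sub>L x else 0) sums x" for j x
  proof -
    have "(if n div 2 = j then cadjoint (if even n = p then id_blinfun else 0)
        o\<^sub>L (if even n = p then id_blinfun else 0) o\<^sub>L x else 0)
        = (if n div 2 = j then (if even n = p then x else 0) else 0)" for n :: nat
      by (auto intro!: blinfun_eqI)
    then show ?thesis
      using parity_sums[of j p x] by simp
  qed
  show "tc_maps (parity_column p) X X"
    unfolding parity_column_def
    by (rule tc_maps_column[OF isometric_parity_column X(1) X(1) _ sums])
      (use 0 in \<open>auto simp: bounded_bilinear.zero_left[OF bounded_bilinear_blinfun_compose]\<close>)
  show "tc_maps (cadjoint (parity_column p)) X X"
    unfolding parity_column_def
    by (rule tc_maps_cadjoint_column[OF isometric_parity_column X(1) X(1)])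
      (use 0 in \<open>auto simp: bounded_bilinear.zero_left[OF bounded_bilinear_blinfun_compose]\<close>)
qed

section \<open>Columns indexed by pairs of natural numbers\<close>

lemma sums_prod_decode:
  fixes f :: "nat \<Rightarrow> 'a :: real_normed_vector"
  assumes "f sums x"
  shows "(\<lambda>n. if fst (prod_decode n) = j then f (snd (prod_decode n)) else 0) sums x"
proof -
  let ?F = "\<lambda>n. if fst (prod_decode n) = j then f (snd (prod_decode n)) else 0"
  \<comment> \<open>The terms of \<open>f\<close> keep their order and zeros are inserted between
    them, so convergence survives without any absolute summability.\<close>
  have "strict_mono (\<lambda>k. prod_encode (j, k))"
    by (simp add: strict_mono_Suc_iff prod_encode_def)
  moreover have "?F n = 0" if "n \<notin> range (\<lambda>k. prod_encode (j, k))" for n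
  proof -
    have "fst (prod_decode n) \<noteq> j"
    proof
      assume "fst (prod_decode n) = j"
      then have "n = prod_encode (j, snd (prod_decode n))"
        by (metis prod.collapse prod_decode_inverse)
      with that show False by blast
    qed
    then show ?thesis by simp
  qed
  ultimately have "(\<lambda>k. ?F (prod_encode (j, k))) sums x \<longleftrightarrow> ?F sums x"
    by (rule sums_mono_reindex)
  then show ?thesis using assms by simp
qed

text \<open>The row with code \<open>(j, k)\<close> applies \<open>b k\<close> to coordinate
  \<open>j\<close>: one infinite column is repeated for every coordinate.\<close>

lemma isometric_column_prod_decode:
  assumes "\<And>k. b k \<in> cblin"
    and "\<And>h. (\<lambda>k. blinfun_apply (cadjoint (b k)) (blinfun_apply (b k) h)) sums h"
  shows "isometric_column (\<lambda>n. fst (prod_decode n)) (\<lambda>n. b (snd (prod_decode n)))"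
  using assms(1) sums_prod_decode[OF assms(2)] by (simp add: isometric_column_def)

text \<open>Two modes of convergence enter: the strong one makes \<open>V\<close> an isometry, and
  the norm one on \<open>X\<close> makes \<open>V\<close> map \<open>X \<otimes> \<K>\<close> into
  \<open>Z \<otimes> \<K>\<close>.\<close>

lemma tc_maps_column_prod_decode:
  assumes b: "\<And>k. b k \<in> cblin"
    "\<And>h. (\<lambda>k. blinfun_apply (cadjoint (b k)) (blinfun_apply (b k) h)) sums h"
    and X: "X \<subseteq> cblin" and Z: "Z \<subseteq> cblin"
    and bX: "\<And>k x. x \<in> X \<Longrightarrow> b k o\<^sub>L x \<in> Z"
    and bZ: "\<And>k z. z \<in> Z \<Longrightarrow> cadjoint (b k) o\<^sub>L z \<in> X"
    and sums: "\<And>x. x \<in> X \<Longrightarrow> (\<lambda>k. cadjoint (b k) o\<^sub>L b k o\<^sub>L x) sums x"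
  obtains V where "V \<in> cblin" "cadjoint V o\<^sub>L V = id_blinfun" "tc_maps V X Z" "tc_maps (cadjoint V) Z X"
proof
  let ?V = "column (\<lambda>n. fst (prod_decode n)) (\<lambda>n. b (snd (prod_decode n)))"
  have c: "isometric_column (\<lambda>n. fst (prod_decode n)) (\<lambda>n. b (snd (prod_decode n)))"
    by (rule isometric_column_prod_decode[OF b])
  show "?V \<in> cblin" "cadjoint ?V o\<^sub>L ?V = id_blinfun"
    using c by (simp_all add: column_isometry)
  show "tc_maps ?V X Z"
    by (rule tc_maps_column[OF c X Z bX sums_prod_decode[OF sums]])
  show "tc_maps (cadjoint ?V) Z X"
    by (rule tc_maps_cadjoint_column[OF c X Z bZ])
qed

section \<open>The swindle\<close>

text \<open>Turns a relation between two factors into a rewrite rule for products nested to the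
  right.\<close>

lemma compose_left_cancel: "S o\<^sub>L T = R \<Longrightarrow> S o\<^sub>L (T o\<^sub>L Q) = R o\<^sub>L Q"
  by (simp add: blinfun_compose_assoc[symmetric])

text \<open>An isometry \<open>T: K \<rightarrow> H\<close> and a splitting \<open>K \<cong> K \<oplus> K\<close> yield a unitary \<open>H \<cong> K \<oplus> H\<close> with
  components \<open>A1\<close>, \<open>A2\<close>: split the range of \<open>T\<close> and leave its complement alone.\<close>

lemma absorb_isometry:
  fixes T :: "'k :: chilbert_space \<Rightarrow>\<^sub>L 'h :: chilbert_space" and E F :: "'k \<Rightarrow>\<^sub>L 'k"
  assumes [simp]: "T \<in> cblin" "E \<in> cblin" "F \<in> cblin"
    and iso: "cadjoint T o\<^sub>L T = id_blinfun" "cadjoint E o\<^sub>L E = id_blinfun" "cadjoint F o\<^sub>L F = id_blinfun"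
    and EF: "(E o\<^sub>L cadjoint E) + (F o\<^sub>L cadjoint F) = id_blinfun"
  defines "A1 \<equiv> cadjoint E o\<^sub>L cadjoint T"
    and "A2 \<equiv> (T o\<^sub>L cadjoint F o\<^sub>L cadjoint T) + (id_blinfun - (T o\<^sub>L cadjoint T))"
  shows "A1 o\<^sub>L cadjoint A1 = id_blinfun" "A2 o\<^sub>L cadjoint A2 = id_blinfun"
    "A1 o\<^sub>L cadjoint A2 = 0" "A2 o\<^sub>L cadjoint A1 = 0"
    "(cadjoint A1 o\<^sub>L A1) + (cadjoint A2 o\<^sub>L A2) = id_blinfun"
proof -
  have EE: "E o\<^sub>L cadjoint E = id_blinfun - (F o\<^sub>L cadjoint F)"
    using EF by (simp add: eq_diff_eq)
  \<comment> \<open>Expanding the left side gives \<open>E^* F\<close> twice, so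
    \<open>E^* F\<close> equals its own double and is zero.\<close>
  have "cadjoint E o\<^sub>L ((E o\<^sub>L cadjoint E) + (F o\<^sub>L cadjoint F)) o\<^sub>L F = cadjoint E o\<^sub>L F"
    by (simp add: EF)
  then have cross: "cadjoint E o\<^sub>L F = 0"
    by (simp add: blinfun_compose_distribs blinfun_compose_assoc compose_left_cancel[OF iso(2)] iso(3))
  then have cross': "cadjoint F o\<^sub>L E = 0"
    by (metis assms(2,3) cadjoint_cadjoint cadjoint_compose cadjoint_zero cblin_cadjoint)
  note rules = blinfun_compose_distribs blinfun_compose_assoc iso cross cross'
    iso[THEN compose_left_cancel] cross[THEN compose_left_cancel] cross'[THEN compose_left_cancel]
  show "A1 o\<^sub>L cadjoint A1 = id_blinfun" "A2 o\<^sub>L cadjoint A2 = id_blinfun"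
    "A1 o\<^sub>L cadjoint A2 = 0" "A2 o\<^sub>L cadjoint A1 = 0"
    by (simp_all add: A1_def A2_def rules)
  show "(cadjoint A1 o\<^sub>L A1) + (cadjoint A2 o\<^sub>L A2) = id_blinfun"
    by (simp add: A1_def A2_def rules compose_left_cancel[OF EE])
qed

text \<open>\<open>A = (A1, A2)\<close> and \<open>B = (B1, B2)\<close> are unitaries onto the same
  direct sum, and \<open>U = B^* A\<close>.\<close>

lemma unitary_of_isometries:
  fixes S :: "'h :: chilbert_space l2 \<Rightarrow>\<^sub>L 'k :: chilbert_space l2" and T :: "'k l2 \<Rightarrow>\<^sub>L 'h l2"
  assumes S: "S \<in> cblin" "cadjoint S o\<^sub>L S = id_blinfun" "tc_maps S X Z" "tc_maps (cadjoint S) Z X"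
    and T: "T \<in> cblin" "cadjoint T o\<^sub>L T = id_blinfun" "tc_maps T Z X" "tc_maps (cadjoint T) X Z"
    and X: "X \<subseteq> cblin" "csubspace X" and Z: "Z \<subseteq> cblin" "csubspace Z"
  obtains U where "unitary U" "tc_maps U X Z" "tc_maps (cadjoint U) Z X"
proof -
  let ?E = "\<lambda>p. parity_column p :: 'k l2 \<Rightarrow>\<^sub>L 'k l2" and ?G = "\<lambda>p. parity_column p :: 'h l2 \<Rightarrow>\<^sub>L 'h l2"
  define A1 where "A1 = cadjoint (?E True) o\<^sub>L cadjoint T"
  define A2 where "A2 = (T o\<^sub>L cadjoint (?E False) o\<^sub>L cadjoint T) + (id_blinfun - (T o\<^sub>L cadjoint T))"
  \<comment> \<open>Numbered against the order of \<open>absorb_isometry\<close>, so that index 1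
    marks the component in \<open>'k l2\<close> and index 2 the one in \<open>'h l2\<close> for both
    unitaries.\<close>
  define B1 where "B1 = (S o\<^sub>L cadjoint (?G False) o\<^sub>L cadjoint S) + (id_blinfun - (S o\<^sub>L cadjoint S))"
  define B2 where "B2 = cadjoint (?G True) o\<^sub>L cadjoint S"
  note A = absorb_isometry[OF T(1) parity_column_cblin parity_column_cblin T(2)
      parity_column_isometry parity_column_isometry parity_column_complement, folded A1_def A2_def]
  note B = absorb_isometry[OF S(1) parity_column_cblin parity_column_cblin S(2)
      parity_column_isometry parity_column_isometry parity_column_complement, folded B1_def B2_def]
  have c [simp]: "A1 \<in> cblin" "A2 \<in> cblin" "B1 \<in> cblin" "B2 \<in> cblin"
    using S(1) T(1) by (simp_all add: A1_def A2_def B1_def B2_def)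
  define U where "U = (cadjoint B1 o\<^sub>L A1) + (cadjoint B2 o\<^sub>L A2)"
  have U': "cadjoint U = (cadjoint A1 o\<^sub>L B1) + (cadjoint A2 o\<^sub>L B2)"
    by (simp add: U_def)
  note rules = blinfun_compose_distribs blinfun_compose_assoc
  note A' = A(1-4)[THEN compose_left_cancel] and B' = B(1-4)[THEN compose_left_cancel]
  have "cadjoint U o\<^sub>L U = id_blinfun"
    unfolding U' U_def using A(5) by (simp add: rules B')
  moreover have "U o\<^sub>L cadjoint U = id_blinfun"
    unfolding U' U_def using B(5) by (simp add: rules A' add.commute)
  moreover have "U \<in> cblin"
    by (simp add: U_def)
  ultimately have "unitary U"
    by (simp add: unitary_def)
  note pX = tc_maps_parity_column[OF X] and pZ = tc_maps_parity_column[OF Z]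
  note complement = tc_maps_diff[OF tc_maps_id tc_maps_compose]
  have m: "tc_maps A1 X Z" "tc_maps A2 X X" "tc_maps B1 Z Z" "tc_maps B2 Z X"
    unfolding A1_def A2_def B1_def B2_def
    by (rule tc_maps_compose[OF T(4) pZ(2)] tc_maps_compose[OF S(4) pX(2)]
        tc_maps_add[OF tc_maps_compose[OF T(4) tc_maps_compose[OF pZ(2) T(3)]] complement[OF T(4,3)]]
        tc_maps_add[OF tc_maps_compose[OF S(4) tc_maps_compose[OF pX(2) S(3)]] complement[OF S(4,3)]])+
  \<comment> \<open>\<open>tc_maps\<close> for an operator says nothing about its adjoint, so the
    adjoint components are expanded and treated separately.\<close>
  have "cadjoint A1 = T o\<^sub>L ?E True" "cadjoint B2 = S o\<^sub>L ?G True"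
    "cadjoint A2 = (T o\<^sub>L ?E False o\<^sub>L cadjoint T) + (id_blinfun - (T o\<^sub>L cadjoint T))"
    "cadjoint B1 = (S o\<^sub>L ?G False o\<^sub>L cadjoint S) + (id_blinfun - (S o\<^sub>L cadjoint S))"
    using S(1) T(1) by (simp_all add: A1_def A2_def B1_def B2_def blinfun_compose_assoc)
  then have m': "tc_maps (cadjoint A1) Z X" "tc_maps (cadjoint A2) X X" "tc_maps (cadjoint B1) Z Z"
    "tc_maps (cadjoint B2) X Z"
    by (simp_all only:)
      (rule tc_maps_compose[OF pZ(1) T(3)] tc_maps_compose[OF pX(1) S(3)]
        tc_maps_add[OF tc_maps_compose[OF T(4) tc_maps_compose[OF pZ(1) T(3)]] complement[OF T(4,3)]]
        tc_maps_add[OF tc_maps_compose[OF S(4) tc_maps_compose[OF pX(1) S(3)]] complement[OF S(4,3)]])+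
  have "tc_maps U X Z" "tc_maps (cadjoint U) Z X"
    unfolding U' unfolding U_def
    by (intro tc_maps_add; rule tc_maps_compose, (rule m m')+)+
  with \<open>unitary U\<close> show ?thesis
    by (rule that)
qed

section \<open>\<open>\<sigma>\<close>-TROs\<close>

text \<open>A three-epsilon argument: the partial sums are uniformly contractive, so reproduction of
  \<open>v\<close> by the series survives limits. The form with an abstract \<open>q\<close> serves
  operators and vectors alike.\<close>

lemma closed_csubspace_sums_fixed:
  fixes q :: "nat \<Rightarrow> 'v :: complex_normed_vector \<Rightarrow> 'v"
  assumes add: "\<And>k u v. q k (u + v) = q k u + q k v"
    and scale: "\<And>k c v. q k (c *\<^sub>C v) = c *\<^sub>C q k v"
    and bound: "\<And>N v. norm (\<Sum>k<N. q k v) \<le> norm v"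
  shows "csubspace {v. (\<lambda>k. q k v) sums v}" "closed {v. (\<lambda>k. q k v) sums v}"
proof -
  have q0: "q k 0 = 0" for k
    using add[of k 0 0] by simp
  show "csubspace {v. (\<lambda>k. q k v) sums v}"
    by (auto simp: complex_vector.subspace_def q0 add scale
        intro: sums_add bounded_linear.sums[OF bounded_linear_scaleC])
  have diff: "q k (u - v) = q k u - q k v" for k u v
    using add[of k "u - v" v] by simp
  show "closed {v. (\<lambda>k. q k v) sums v}"
    unfolding closed_sequential_limits
  proof (intro allI impI, elim conjE)
    fix w v assume w: "\<forall>n. w n \<in> {v. (\<lambda>k. q k v) sums v}" "w \<longlonglongrightarrow> v"
    have "(\<lambda>N. \<Sum>k<N. q k v) \<longlonglongrightarrow> v"
    proof (rule LIMSEQ_I)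
      fix r :: real assume "r > 0"
      then obtain n where n: "norm (w n - v) < r / 3"
        using LIMSEQ_D[OF w(2), of "r / 3"] by auto
      have "(\<lambda>N. \<Sum>k<N. q k (w n)) \<longlonglongrightarrow> w n"
        using w(1) by (simp add: sums_def)
      then obtain N0 where N0: "\<And>N. N \<ge> N0 \<Longrightarrow> norm ((\<Sum>k<N. q k (w n)) - w n) < r / 3"
        using LIMSEQ_D[of _ "w n" "r / 3"] \<open>r > 0\<close> by auto
      have "norm ((\<Sum>k<N. q k v) - v) < r" if "N \<ge> N0" for N
      proof -
        have "(\<Sum>k<N. q k v) - v = (w n - v) + ((\<Sum>k<N. q k (w n)) - w n) - (\<Sum>k<N. q k (w n - v))"
          by (simp add: diff sum_subtractf)
        also have "norm \<dots> \<le> norm (w n - v) + norm ((\<Sum>k<N. q k (w n)) - w n) + norm (\<Sum>k<N. q k (w n - v))"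
          by (intro order_trans[OF norm_triangle_ineq4] add_mono norm_triangle_ineq order_refl)
        also have "\<dots> < r"
          using n N0[OF that] bound[of "w n - v" N] by linarith
        finally show ?thesis .
      qed
      then show "\<exists>no. \<forall>N\<ge>no. norm ((\<Sum>k<N. q k v) - v) < r"
        by blast
    qed
    then show "v \<in> {v. (\<lambda>k. q k v) sums v}"
      by (simp add: sums_def)
  qed
qed

text \<open>As the partial sums of \<open>p\<close> are contractions, their acting as an identity on
  \<open>A\<close> extends to closed spans: in norm to operators factoring through \<open>A\<close>
  on the left, and pointwise to vectors in the ranges of \<open>A\<close>. These are the two modes
  of convergence required of a column.\<close>

lemma sums_fixed_closure:
  fixes p :: "nat \<Rightarrow> 'h :: chilbert_space \<Rightarrow>\<^sub>L 'h"
    and A :: "('k :: chilbert_space \<Rightarrow>\<^sub>L 'h) set"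
  assumes p: "\<And>k. p k \<in> cblin" "\<And>k. norm (\<Sum>i\<le>k. p i) \<le> 1"
    and A: "\<And>a. a \<in> A \<Longrightarrow> (\<lambda>k. p k o\<^sub>L a) sums a"
  shows "(w :: 'g :: chilbert_space \<Rightarrow>\<^sub>L 'h) \<in> closure (cspan {a o\<^sub>L w | a w. a \<in> A}) \<Longrightarrow> (\<lambda>k. p k o\<^sub>L w) sums w"
    and "h \<in> closure (cspan {blinfun_apply a g | a g. a \<in> A}) \<Longrightarrow> (\<lambda>k. blinfun_apply (p k) h) sums h"
proof -
  \<comment> \<open>Passes from sums over \<open>i \<le> k\<close> to sums over
    \<open>i < N\<close>; \<open>N = 0\<close> gives the empty sum.\<close>
  have p': "norm (\<Sum>i<N. p i) \<le> 1" for N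
    by (cases N) (simp_all add: p(2) lessThan_Suc_atMost)
  let ?B = "{w :: 'g \<Rightarrow>\<^sub>L 'h. (\<lambda>k. p k o\<^sub>L w) sums w}"
  have "norm (\<Sum>k<N. p k o\<^sub>L w) \<le> norm w" for N and w :: "'g \<Rightarrow>\<^sub>L 'h"
  proof -
    have "(\<Sum>k<N. p k o\<^sub>L w) = (\<Sum>k<N. p k) o\<^sub>L w"
      by (rule bounded_bilinear.sum_left[OF bounded_bilinear_blinfun_compose, symmetric])
    then show ?thesis
      using norm_blinfun_compose[of "\<Sum>k<N. p k" w] mult_right_mono[OF p'[of N] norm_ge_zero[of w]]
      by simp
  qed
  then have B: "csubspace ?B" "closed ?B"
    by (intro closed_csubspace_sums_fixed; simp add: blinfun_compose_add_right
        blinfun_compose_scaleC_right p(1))+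
  have "(\<lambda>k. p k o\<^sub>L (a o\<^sub>L w)) sums (a o\<^sub>L w)" if "a \<in> A" for a and w :: "'g \<Rightarrow>\<^sub>L 'k"
    using bounded_linear.sums[OF bounded_bilinear.bounded_linear_left[OF
          bounded_bilinear_blinfun_compose] A[OF that], of w]
    by (simp add: blinfun_compose_assoc)
  then have "closure (cspan {a o\<^sub>L w | a w. a \<in> A}) \<subseteq> ?B"
    by (intro closure_cspan_minimal B) auto
  then show "w \<in> closure (cspan {a o\<^sub>L w | a w. a \<in> A}) \<Longrightarrow> (\<lambda>k. p k o\<^sub>L w) sums w"
    by blast
  let ?C = "{h. (\<lambda>k. blinfun_apply (p k) h) sums h}"
  have "norm (\<Sum>k<N. blinfun_apply (p k) h) \<le> norm h" for N h
    using norm_blinfun[of "\<Sum>k<N. p k" h] mult_right_mono[OF p'[of N] norm_ge_zero[of h]]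
    by (simp add: blinfun.sum_left)
  then have C: "csubspace ?C" "closed ?C"
    by (intro closed_csubspace_sums_fixed; simp add: blinfun.add_right cblinD p(1))+
  have "(\<lambda>k. blinfun_apply (p k) (blinfun_apply a g)) sums blinfun_apply a g" if "a \<in> A" for a g
    using bounded_linear.sums[OF blinfun.bounded_linear_left A[OF that], of g] by simp
  then have "closure (cspan {blinfun_apply a g | a g. a \<in> A}) \<subseteq> ?C"
    by (intro closure_cspan_minimal C) auto
  then show "h \<in> closure (cspan {blinfun_apply a g | a g. a \<in> A}) \<Longrightarrow> (\<lambda>k. blinfun_apply (p k) h) sums h"
    by blast
qed

text \<open>The blocks \<open>m k\<close> give the isometry \<open>S\<close> and the blocks
  \<open>cadjoint (n k)\<close> give \<open>T\<close>. The inclusions \<open>X_sub\<close> and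
  \<open>Z_sub\<close> provide the norm convergence on \<open>X\<close> and \<open>Z\<close>, and
  \<open>nondeg\<close> the strong convergence on the whole spaces.\<close>

lemma sigma_TRO_unitary:
  fixes M :: "('h :: chilbert_space \<Rightarrow>\<^sub>L 'k :: chilbert_space) set"
    and X :: "('g :: chilbert_space \<Rightarrow>\<^sub>L 'h) set" and Z :: "('g \<Rightarrow>\<^sub>L 'k) set"
  assumes M: "sigma_TRO M"
    and X: "X \<subseteq> cblin" "csubspace X" and Z: "Z \<subseteq> cblin" "csubspace Z"
    and MX: "\<And>a x. a \<in> M \<Longrightarrow> x \<in> X \<Longrightarrow> a o\<^sub>L x \<in> Z"
    and MZ: "\<And>a z. a \<in> M \<Longrightarrow> z \<in> Z \<Longrightarrow> cadjoint a o\<^sub>L z \<in> X"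
    and X_sub: "X \<subseteq> closure (cspan {cadjoint a o\<^sub>L w | a (w :: 'g \<Rightarrow>\<^sub>L 'k). a \<in> M})"
    and Z_sub: "Z \<subseteq> closure (cspan {a o\<^sub>L w | a (w :: 'g \<Rightarrow>\<^sub>L 'h). a \<in> M})"
    and nondeg: "closure (cspan {blinfun_apply (cadjoint a) g | a g. a \<in> M}) = UNIV"
      "closure (cspan {blinfun_apply a g | a g. a \<in> M}) = UNIV"
  obtains U where "unitary U" "tensor_compact Z = (\<lambda>T. U o\<^sub>L T) ` tensor_compact X"
proof -
  obtain m n :: "nat \<Rightarrow> 'h \<Rightarrow>\<^sub>L 'k" where mM: "range m \<subseteq> M" and nM: "range n \<subseteq> M"
    and m1: "\<And>k. norm (\<Sum>i\<le>k. cadjoint (m i) o\<^sub>L m i) \<le> 1"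
    and n1: "\<And>k. norm (\<Sum>i\<le>k. n i o\<^sub>L cadjoint (n i)) \<le> 1"
    and ms: "\<And>x. x \<in> M \<Longrightarrow> (\<lambda>k. x o\<^sub>L cadjoint (m k) o\<^sub>L m k) sums x"
    and ns: "\<And>x. x \<in> M \<Longrightarrow> (\<lambda>k. n k o\<^sub>L cadjoint (n k) o\<^sub>L x) sums x"
    using M unfolding sigma_TRO_def by blast
  have Mc: "M \<subseteq> cblin"
    using M by (simp add: sigma_TRO_def TRO_def)
  have mn: "m k \<in> M" "n k \<in> M" for k
    using mM nM by blast+
  with Mc have [simp]: "m k \<in> cblin" "n k \<in> cblin" for k
    by blast+
  \<comment> \<open>Taking adjoints turns the right identity on \<open>M\<close> into a left
    identity on the adjoints of elements of \<open>M\<close>.\<close>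
  have ms': "(\<lambda>k. cadjoint (m k) o\<^sub>L m k o\<^sub>L a) sums a" if a: "a \<in> cadjoint ` M" for a
  proof -
    obtain b where b: "b \<in> M" "a = cadjoint b"
      using a by blast
    have bc [simp]: "b \<in> cblin"
      using b Mc by blast
    have "(\<lambda>k. cadjoint (b o\<^sub>L cadjoint (m k) o\<^sub>L m k)) sums cadjoint b"
      by (rule sums_cadjoint[OF _ ms[OF b(1)]]) simp_all
    then show ?thesis
      by (simp add: b(2) blinfun_compose_assoc)
  qed
  have img: "{cadjoint a o\<^sub>L w | a (w :: 'g \<Rightarrow>\<^sub>L 'k). a \<in> M} = {a o\<^sub>L w | a w. a \<in> cadjoint ` M}"
    "{blinfun_apply (cadjoint a) g | a g. a \<in> M} = {blinfun_apply a g | a g. a \<in> cadjoint ` M}"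
    by blast+
  have m_sums: "(\<lambda>k. cadjoint (m k) o\<^sub>L m k o\<^sub>L x) sums x" if x: "x \<in> X" for x
    by (rule sums_fixed_closure(1)[OF _ m1 ms' subsetD[OF X_sub[unfolded img] x]]) simp
  have m_strong: "(\<lambda>k. blinfun_apply (cadjoint (m k) o\<^sub>L m k) h) sums h" for h
    by (rule sums_fixed_closure(2)[OF _ m1 ms' subsetD[OF equalityD2[OF nondeg(1)[unfolded img]] UNIV_I]])
      simp
  have n_sums: "(\<lambda>k. n k o\<^sub>L cadjoint (n k) o\<^sub>L z) sums z" if "z \<in> Z" for z
    by (rule sums_fixed_closure(1)[OF _ n1 ns subsetD[OF Z_sub that]]) simp
  have n_strong: "(\<lambda>k. blinfun_apply (n k o\<^sub>L cadjoint (n k)) h) sums h" for h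
    by (rule sums_fixed_closure(2)[OF _ n1 ns subsetD[OF equalityD2[OF nondeg(2)] UNIV_I]]) simp
  obtain S where S: "S \<in> cblin" "cadjoint S o\<^sub>L S = id_blinfun" "tc_maps S X Z" "tc_maps (cadjoint S) Z X"
    by (rule tc_maps_column_prod_decode[of m X Z]) (use mn MX MZ m_sums m_strong X Z in auto)
  obtain T where T: "T \<in> cblin" "cadjoint T o\<^sub>L T = id_blinfun" "tc_maps T Z X" "tc_maps (cadjoint T) X Z"
    by (rule tc_maps_column_prod_decode[of "\<lambda>k. cadjoint (n k)" Z X])
      (use mn MX MZ n_sums n_strong X Z in auto)
  obtain U where U: "unitary U" "tc_maps U X Z" "tc_maps (cadjoint U) Z X"
    using unitary_of_isometries[OF S T X Z] by blast
  have "tensor_compact Z = (\<lambda>T. U o\<^sub>L T) ` tensor_compact X"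
  proof (intro equalityI subsetI)
    fix V assume "V \<in> tensor_compact Z"
    then have "cadjoint U o\<^sub>L V \<in> tensor_compact X"
      using U(3) by (simp add: tc_maps_def)
    moreover have "V = U o\<^sub>L (cadjoint U o\<^sub>L V)"
      using U(1) by (simp add: unitary_def flip: blinfun_compose_assoc)
    ultimately show "V \<in> (\<lambda>T. U o\<^sub>L T) ` tensor_compact X"
      by blast
  qed (use U(2) in \<open>auto simp: tc_maps_def\<close>)
  with U(1) show ?thesis
    by (rule that)
qed

section \<open>From \<open>X\<close> to \<open>Y\<close> through an intermediate space\<close>

theorem theorem5p3:
  fixes X :: "('h1 :: chilbert_space \<Rightarrow>\<^sub>L 'h2 :: chilbert_space) set"
    and Y :: "('k1 :: chilbert_space \<Rightarrow>\<^sub>L 'k2 :: chilbert_space) set"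
  assumes "X \<subseteq> cblin" "csubspace X" "closed X"
    and "Y \<subseteq> cblin" "csubspace Y" "closed Y"
    and "sigma_strongly_TRO_equivalent X Y"
    and "acts_nondegenerately X" "acts_nondegenerately Y"
  shows "\<exists>(U1 :: 'h1 l2 \<Rightarrow>\<^sub>L 'k1 l2) (U2 :: 'h2 l2 \<Rightarrow>\<^sub>L 'k2 l2).
    unitary U1 \<and> unitary U2 \<and>
    tensor_compact Y = (\<lambda>T. U2 o\<^sub>L T o\<^sub>L cadjoint U1) ` tensor_compact X"
proof -
  obtain M1 :: "('h1 \<Rightarrow>\<^sub>L 'k1) set" and M2 :: "('h2 \<Rightarrow>\<^sub>L 'k2) set"
    where M: "sigma_TRO M1" "sigma_TRO M2"
      and X_eq: "X = closure (cspan {cadjoint b o\<^sub>L y o\<^sub>L a | a b y. a \<in> M1 \<and> b \<in> M2 \<and> y \<in> Y})"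
      and Y_eq: "Y = closure (cspan {b o\<^sub>L x o\<^sub>L cadjoint a | a b x. a \<in> M1 \<and> b \<in> M2 \<and> x \<in> X})"
    using assms(7) unfolding sigma_strongly_TRO_equivalent_def by blast
  have M1c: "a \<in> cblin" if "a \<in> M1" for a
    using that M by (auto simp: sigma_TRO_def TRO_def)
  have M2c: "b \<in> cblin" if "b \<in> M2" for b
    using that M by (auto simp: sigma_TRO_def TRO_def)
  have Xc: "x \<in> cblin" if "x \<in> X" for x
    using that assms by blast
  have Yc: "y \<in> cblin" if "y \<in> Y" for y
    using that assms by blast
  note c [simp] = M1c M2c Xc Yc
  have tro1: "a o\<^sub>L (cadjoint b o\<^sub>L d) \<in> M1" if "a \<in> M1" "b \<in> M1" "d \<in> M1" for a b d
    using that M(1) by (simp add: sigma_TRO_def TRO_def blinfun_compose_assoc)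
  have tro2: "a o\<^sub>L (cadjoint b o\<^sub>L d) \<in> M2" if "a \<in> M2" "b \<in> M2" "d \<in> M2" for a b d
    using that M(2) by (simp add: sigma_TRO_def TRO_def blinfun_compose_assoc)
  have X_base: "cadjoint b o\<^sub>L y o\<^sub>L a \<in> X" if "a \<in> M1" "b \<in> M2" "y \<in> Y" for a b y
    by (subst X_eq, rule closure_cspan_base) (use that in blast)
  have Y_base: "b o\<^sub>L x o\<^sub>L cadjoint a \<in> Y" if "a \<in> M1" "b \<in> M2" "x \<in> X" for a b x
    by (subst Y_eq, rule closure_cspan_base) (use that in blast)
  define G where "G = {b o\<^sub>L x | b x. b \<in> M2 \<and> x \<in> X}"
  define Z where "Z = closure (cspan G)"
  have Z_base: "b o\<^sub>L x \<in> Z" if "b \<in> M2" "x \<in> X" for b x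
    unfolding Z_def G_def by (rule closure_cspan_base) (use that in blast)
  have Gc: "G \<subseteq> cblin"
    by (auto simp: G_def)
  have Z: "Z \<subseteq> cblin" "csubspace Z" "closed Z"
    unfolding Z_def using Gc by (simp_all add: closure_cspan_subset_cblin csubspace_closure_cspan)

  have M2Z: "cadjoint a o\<^sub>L z \<in> X" if a: "a \<in> M2" and z: "z \<in> Z" for a z
  proof (rule closure_cspan_compose_left[OF _ assms(2,3) _ z[unfolded Z_def]])
    fix g assume "g \<in> G"
    then obtain b x where b: "b \<in> M2" and x: "x \<in> X" and g: "g = b o\<^sub>L x"
      unfolding G_def by blast
    have "(cadjoint a o\<^sub>L b) o\<^sub>L x \<in> X"
    proof (rule closure_cspan_compose_left[OF _ assms(2,3) _ x[unfolded X_eq]])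
      fix t assume "t \<in> {cadjoint b o\<^sub>L y o\<^sub>L a | a b y. a \<in> M1 \<and> b \<in> M2 \<and> y \<in> Y}"
      then obtain a' b' y where t: "a' \<in> M1" "b' \<in> M2" "y \<in> Y" "t = cadjoint b' o\<^sub>L y o\<^sub>L a'"
        by blast
      \<comment> \<open>\<open>a^* b b'^*\<close> is the adjoint of \<open>b' b^* a\<close>, which
        lies in \<open>M2\<close> by the TRO property, so the product is again a generator of
        \<open>X\<close>.\<close>
      have "(cadjoint a o\<^sub>L b) o\<^sub>L t = cadjoint (b' o\<^sub>L (cadjoint b o\<^sub>L a)) o\<^sub>L y o\<^sub>L a'"
        using a b t by (simp add: blinfun_compose_assoc)
      then show "(cadjoint a o\<^sub>L b) o\<^sub>L t \<in> X"
        by (simp only:) (intro X_base tro2 a b t)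
    qed (use a b in simp)
    then show "cadjoint a o\<^sub>L g \<in> X"
      by (simp add: g blinfun_compose_assoc)
  qed (use a in simp)
  obtain U2 where U2: "unitary U2" "tensor_compact Z = (\<lambda>T. U2 o\<^sub>L T) ` tensor_compact X"
  proof (rule sigma_TRO_unitary[OF M(2) assms(1,2) Z(1,2)])
    show "X \<subseteq> closure (cspan {cadjoint a o\<^sub>L w | a w. a \<in> M2})"
      by (subst X_eq, intro closure_mono complex_vector.span_mono)
        (auto simp: blinfun_compose_assoc)
    show "Z \<subseteq> closure (cspan {a o\<^sub>L w | a w. a \<in> M2})"
      unfolding Z_def G_def by (intro closure_mono complex_vector.span_mono) blast
    \<comment> \<open>Nondegeneracy of \<open>M2\<close> is inherited: generators of
      \<open>X\<close> begin with some \<open>b^*\<close> and those of \<open>Y\<close> with some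
      \<open>b\<close>, so the ranges of \<open>X\<close> and \<open>Y\<close> lie in the closed
      spans in question.\<close>
    let ?C = "closure (cspan {blinfun_apply (cadjoint a) g | a g. a \<in> M2})"
    have "blinfun_apply x h \<in> ?C" if "x \<in> X" for x h
      by (rule closure_cspan_apply[OF csubspace_closure_cspan closed_closure _ that[unfolded X_eq]])
        (clarsimp, rule closure_cspan_base, blast)
    then have "closure (cspan {blinfun_apply x h | x h. x \<in> X}) \<subseteq> ?C"
      by (intro closure_cspan_minimal csubspace_closure_cspan closed_closure) auto
    then show "?C = UNIV"
      using assms(8) by (simp add: acts_nondegenerately_def top.extremum_unique)
    let ?D = "closure (cspan {blinfun_apply a g | a g. a \<in> M2})"
    have "blinfun_apply y h \<in> ?D" if "y \<in> Y" for y h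
      by (rule closure_cspan_apply[OF csubspace_closure_cspan closed_closure _ that[unfolded Y_eq]])
        (clarsimp, rule closure_cspan_base, blast)
    then have "closure (cspan {blinfun_apply y h | y h. y \<in> Y}) \<subseteq> ?D"
      by (intro closure_cspan_minimal csubspace_closure_cspan closed_closure) auto
    then show "?D = UNIV"
      using assms(9) by (simp add: acts_nondegenerately_def top.extremum_unique)
  qed (use Z_base M2Z in auto)

  have XM1: "x o\<^sub>L (cadjoint a' o\<^sub>L a) \<in> X" if a: "a \<in> M1" "a' \<in> M1" and x: "x \<in> X" for a a' x
  proof (rule closure_cspan_compose_right[OF assms(2,3) _ x[unfolded X_eq]])
    fix t assume "t \<in> {cadjoint b o\<^sub>L y o\<^sub>L a | a b y. a \<in> M1 \<and> b \<in> M2 \<and> y \<in> Y}"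
    then obtain a'' b y where t: "a'' \<in> M1" "b \<in> M2" "y \<in> Y" "t = cadjoint b o\<^sub>L y o\<^sub>L a''"
      by blast
    have "t o\<^sub>L (cadjoint a' o\<^sub>L a) = cadjoint b o\<^sub>L y o\<^sub>L (a'' o\<^sub>L (cadjoint a' o\<^sub>L a))"
      by (simp add: t blinfun_compose_assoc)
    then show "t o\<^sub>L (cadjoint a' o\<^sub>L a) \<in> X"
      by (simp only:) (intro X_base tro1 a t)
  qed
  have ZM1: "z o\<^sub>L cadjoint a \<in> Y" if a: "a \<in> M1" and z: "z \<in> Z" for a z
    by (rule closure_cspan_compose_right[OF assms(5,6) _ z[unfolded Z_def]])
      (use Y_base a in \<open>auto simp: G_def\<close>)
  \<comment> \<open>A generator \<open>b x a'^*\<close> times \<open>a\<close> is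
    \<open>b (x a'^* a)\<close>, and \<open>XM1\<close> keeps the bracket in
    \<open>X\<close>.\<close>
  have YM1: "y o\<^sub>L a \<in> Z" if a: "a \<in> M1" and y: "y \<in> Y" for a y
  proof (rule closure_cspan_compose_right[OF Z(2,3) _ y[unfolded Y_eq]])
    fix t assume "t \<in> {b o\<^sub>L x o\<^sub>L cadjoint a | a b x. a \<in> M1 \<and> b \<in> M2 \<and> x \<in> X}"
    then show "t o\<^sub>L a \<in> Z"
      using Z_base XM1 a by (auto simp: blinfun_compose_assoc)
  qed
  have X_adj: "cadjoint ` X = closure (cspan (cadjoint `
      {cadjoint b o\<^sub>L y o\<^sub>L a | a b y. a \<in> M1 \<and> b \<in> M2 \<and> y \<in> Y}))"
    by (subst X_eq, rule cadjoint_closure_cspan) auto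
  have Y_adj: "cadjoint ` Y = closure (cspan (cadjoint `
      {b o\<^sub>L x o\<^sub>L cadjoint a | a b x. a \<in> M1 \<and> b \<in> M2 \<and> x \<in> X}))"
    by (subst Y_eq, rule cadjoint_closure_cspan) auto
  \<comment> \<open>The adjoint of \<open>b^* y a\<close> is \<open>a^* y^* b\<close>, which moves
    the factor from \<open>M1\<close> to the left end; \<open>Y\<close> is treated in the same way
    next.\<close>
  have X_adj_gen: "\<exists>a w. a \<in> M1 \<and> t = cadjoint a o\<^sub>L w"
    if "t \<in> cadjoint ` {cadjoint b o\<^sub>L y o\<^sub>L a | a b y. a \<in> M1 \<and> b \<in> M2 \<and> y \<in> Y}" for t
    using that by (clarsimp simp: blinfun_compose_assoc) blast
  have Y_adj_gen: "\<exists>a w. a \<in> M1 \<and> t = a o\<^sub>L w"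
    if "t \<in> cadjoint ` {b o\<^sub>L x o\<^sub>L cadjoint a | a b x. a \<in> M1 \<and> b \<in> M2 \<and> x \<in> X}" for t
    using that by (clarsimp simp: blinfun_compose_assoc) blast
  obtain U1 where U1: "unitary U1"
    "tensor_compact (cadjoint ` Y) = (\<lambda>T. U1 o\<^sub>L T) ` tensor_compact (cadjoint ` Z)"
  proof (rule sigma_TRO_unitary[OF M(1), of "cadjoint ` Z" "cadjoint ` Y"])
    show "cadjoint ` Z \<subseteq> cblin" "cadjoint ` Y \<subseteq> cblin"
      using Z assms by auto
    show "csubspace (cadjoint ` Z)" "csubspace (cadjoint ` Y)"
      using Z assms by (auto intro: csubspace_cadjoint_image)
    show "a o\<^sub>L z \<in> cadjoint ` Y" if "a \<in> M1" "z \<in> cadjoint ` Z" for a z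
      using that ZM1 Z(1) assms(4) by (auto simp: cadjoint_image_iff)
    show "cadjoint a o\<^sub>L y \<in> cadjoint ` Z" if "a \<in> M1" "y \<in> cadjoint ` Y" for a y
      using that YM1 Z(1) assms(4) by (auto simp: cadjoint_image_iff)
    let ?E = "closure (cspan {cadjoint a o\<^sub>L w | a (w :: 'k2 \<Rightarrow>\<^sub>L 'k1). a \<in> M1})"
    show "cadjoint ` Z \<subseteq> ?E"
      unfolding Z_def cadjoint_closure_cspan[OF Gc]
    proof (intro closure_cspan_minimal csubspace_closure_cspan closed_closure subsetI)
      fix t assume "t \<in> cadjoint ` G"
      then obtain b x where b: "b \<in> M2" and x: "x \<in> X" and t: "t = cadjoint x o\<^sub>L cadjoint b"
        by (auto simp: G_def)
      \<comment> \<open>\<open>x^*\<close> is approximated by sums of operators that begin with some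
        \<open>a^*\<close>; multiplying by \<open>b^*\<close> on the right keeps this form.\<close>
      have "cadjoint x \<in> cadjoint ` X"
        using x by blast
      then show "t \<in> ?E"
        unfolding t X_adj
        by (rule closure_cspan_compose_right[OF csubspace_closure_cspan closed_closure, rotated])
          (use X_adj_gen in \<open>force intro!: closure_cspan_base simp: blinfun_compose_assoc\<close>)
    qed
    show "cadjoint ` Y \<subseteq> closure (cspan {a o\<^sub>L w | a w. a \<in> M1})"
      unfolding Y_adj by (intro closure_mono complex_vector.span_mono) (use Y_adj_gen in blast)
    let ?C = "closure (cspan {blinfun_apply (cadjoint a) g | a g. a \<in> M1})"
    have "blinfun_apply (cadjoint x) h \<in> ?C" if "x \<in> X" for x h
    proof (rule closure_cspan_apply[OF csubspace_closure_cspan closed_closure])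
      show "cadjoint x \<in> closure (cspan (cadjoint `
          {cadjoint b o\<^sub>L y o\<^sub>L a | a b y. a \<in> M1 \<and> b \<in> M2 \<and> y \<in> Y}))"
        using that X_adj by blast
    qed (use X_adj_gen in \<open>fastforce intro!: closure_cspan_base\<close>)
    then have "closure (cspan {blinfun_apply (cadjoint x) h | x h. x \<in> X}) \<subseteq> ?C"
      by (intro closure_cspan_minimal csubspace_closure_cspan closed_closure) auto
    then show "?C = UNIV"
      using assms(8) by (simp add: acts_nondegenerately_def top.extremum_unique)
    let ?D = "closure (cspan {blinfun_apply a g | a g. a \<in> M1})"
    have "blinfun_apply (cadjoint y) h \<in> ?D" if "y \<in> Y" for y h
    proof (rule closure_cspan_apply[OF csubspace_closure_cspan closed_closure])
      show "cadjoint y \<in> closure (cspan (cadjoint `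
          {b o\<^sub>L x o\<^sub>L cadjoint a | a b x. a \<in> M1 \<and> b \<in> M2 \<and> x \<in> X}))"
        using that Y_adj by blast
    qed (use Y_adj_gen in \<open>fastforce intro!: closure_cspan_base\<close>)
    then have "closure (cspan {blinfun_apply (cadjoint y) h | y h. y \<in> Y}) \<subseteq> ?D"
      by (intro closure_cspan_minimal csubspace_closure_cspan closed_closure) auto
    then show "?D = UNIV"
      using assms(9) by (simp add: acts_nondegenerately_def top.extremum_unique)
  qed

  have U1c: "U1 \<in> cblin"
    using U1(1) by (simp add: unitary_def)
  have tcY: "tensor_compact Y \<subseteq> cblin" and tcZ: "tensor_compact Z \<subseteq> cblin"
    using assms(4) Z(1) by (auto dest: tensor_compact_subset_cblin)
  \<comment> \<open>Conjugating by the adjoint turns left multiplication by \<open>U1\<close> into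
    right multiplication by its adjoint.\<close>
  have "tensor_compact Y = cadjoint ` cadjoint ` tensor_compact Y"
    using tcY by (force simp: image_image)
  also have "\<dots> = cadjoint ` (\<lambda>T. U1 o\<^sub>L T) ` cadjoint ` tensor_compact Z"
    using U1(2) assms(4) Z(1) by (simp add: tensor_compact_cadjoint)
  also have "\<dots> = (\<lambda>T. T o\<^sub>L cadjoint U1) ` tensor_compact Z"
    unfolding image_image using tcZ U1c by (intro image_cong) auto
  also have "\<dots> = (\<lambda>T. U2 o\<^sub>L T o\<^sub>L cadjoint U1) ` tensor_compact X"
    unfolding U2(2) image_image ..
  finally show ?thesis
    using U1(1) U2(1) by blast
qed

end
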